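(* Let $N=1$ or $N=2$, let $2\leq q<\infty$, and put $\theta=\frac N2\left(1-\frac 2q\right)$. Then there is a constant $K_{N,\theta}>0$, depending only on $N$ and $\theta$, such that for any domain $\Omega\subsetneq\mathbb{R}^N$ and any $u\in C_0^\infty(\Omega)$ $$ \left( \int_\Omega \left( |\nabla u|^2 - \frac{|u|^2}{4D_\Omega^2} \right) dx \right)^\theta \left( \int_\Omega |u|^2 \,dx \right)^{1-\theta} \geq K_{N,\theta} \left( \int_\Omega |u|^q \,dx \right)^{\frac 2q} . $$
   Context: A domain is a nonempty connected open set; $\Omega^c=\mathbb{R}^N\setminus\Omega$. $C_0^\infty(\Omega)$ denotes the smooth (complex-valued) functions with compact support in $\Omega$. For $x\in\Omega$ and $e\in\mathbb{S}^{N-1}$ (the unit sphere in $\mathbb{R}^N$, with surface measure $de$ and total measure $|\mathbb{S}^{N-1}|$; for $N=1$, $\mathbb{S}^0=\{-1,1\}$ with counting measure and $|\mathbb{S}^0|=2$) set $$d_e(x) := \inf\{ |t| : t\in\mathbb{R},\ x+te \in\Omega^c \},$$ with $\inf\emptyset=+\infty$ and $(+\infty)^{-2}=0$. The weight $D_\Omega$ is $$D_\Omega(x) := \left( N |\mathbb{S}^{N-1}|^{-1} \int_{\mathbb{S}^{N-1}} d_e(x)^{-2} \,de \right)^{-\frac12},$$ i.e. $D_\Omega(x)^{-2}= N |\mathbb{S}^{N-1}|^{-1} \int_{\mathbb{S}^{N-1}} d_e(x)^{-2} \,de$. (The integral $\int_\Omega ( |\nabla u|^2 - |u|^2/(4D_\Omega^2))\,dx$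 is non-negative by Davies' Hardy inequality, so its $\theta$-th power makes sense; a $0$-th power is read as $1$.) *)

theory Defs
  imports "HOL-Analysis.Analysis"
begin

definition is_domain :: "'a::topological_space set \<Rightarrow> bool" where
  "is_domain \<Omega> \<longleftrightarrow> open \<Omega> \<and> connected \<Omega> \<and> \<Omega> \<noteq> {}"

text \<open>A function is \<open>C\<^sup>k\<close> for all \<open>k\<close>; a function that is everywhere (Frechet) differentiable
  with \<open>C\<^sup>k\<close> partial derivatives is \<open>C\<^sup>k\<^sup>+\<^sup>1\<close>, and conversely.\<close>

primrec Ck :: "nat \<Rightarrow> ('a::euclidean_space \<Rightarrow> 'b::real_normed_vector) \<Rightarrow> bool" where
  "Ck 0 f \<longleftrightarrow> continuous_on UNIV f"
| "Ck (Suc k) f \<longleftrightarrow> (\<forall>x. f differentiable (at x)) \<and>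
     (\<forall>b\<in>Basis. Ck k (\<lambda>x. frechet_derivative f (at x) b))"

definition smooth :: "('a::euclidean_space \<Rightarrow> 'b::real_normed_vector) \<Rightarrow> bool" where
  "smooth f \<longleftrightarrow> (\<forall>k. Ck k f)"

text \<open>Functions in \<open>C\<^sub>0\<^sup>\<infinity>(\<Omega>)\<close> are identified with their extensions by zero to the whole space.\<close>

definition C0_infty :: "'a::euclidean_space set \<Rightarrow> ('a \<Rightarrow> complex) set" where
  "C0_infty \<Omega> =
     {u. smooth u \<and> compact (closure {x. u x \<noteq> 0}) \<and> closure {x. u x \<noteq> 0} \<subseteq> \<Omega>}"

definition grad_norm_sq :: "('a::euclidean_space \<Rightarrow> complex) \<Rightarrow> 'a \<Rightarrow> real" where
  "grad_norm_sq u x = (\<Sum>b\<in>Basis. (cmod (frechet_derivative u (at x) b))\<^sup>2)"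

text \<open>Surface measure on the unit sphere via polar coordinates: \<open>\<sigma>(A) = N \<cdot> |{r e : 0 < r < 1, e \<in> A}|\<close>.
  In dimension one this is counting measure on the two unit vectors, see
  \<open>emeasure_sphere_measure_dim1\<close> below.\<close>

definition sphere_measure :: "'a::euclidean_space measure" where
  "sphere_measure = scale_measure (of_nat DIM('a))
     (distr (restrict_space lborel (ball 0 1 - {0})) (restrict_space borel (sphere 0 1))
       (\<lambda>x. x /\<^sub>R norm x))"

text \<open>In \<^typ>\<open>ennreal\<close> we have \<open>Inf {} = \<infinity>\<close>, \<open>inverse 0 = \<infinity>\<close> and \<open>inverse \<infinity> = 0\<close>.\<close>

definition dir_dist :: "'a::euclidean_space set \<Rightarrow> 'a \<Rightarrow> 'a \<Rightarrow> ennreal" where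
  "dir_dist \<Omega> e x = (INF t\<in>{t::real. x + t *\<^sub>R e \<in> - \<Omega>}. ennreal \<bar>t\<bar>)"

definition inv_sqrt_ennreal :: "ennreal \<Rightarrow> ennreal" where
  "inv_sqrt_ennreal a = (if a = \<infinity> then 0 else inverse (ennreal (sqrt (enn2real a))))"

text \<open>The value of \<open>hardy_weight\<close> may be \<open>\<infinity>\<close>, for instance on the complement of a point in the plane.\<close>

definition hardy_weight :: "'a::euclidean_space set \<Rightarrow> 'a \<Rightarrow> ennreal" where
  "hardy_weight \<Omega> x = inv_sqrt_ennreal
     (of_nat DIM('a) / emeasure sphere_measure (sphere (0::'a) 1) *
       (\<integral>\<^sup>+ e. inverse ((dir_dist \<Omega> e x)\<^sup>2) \<partial>sphere_measure))"

text \<open>Real powers with \<open>x\<^sup>0 = 1\<close> for all \<open>x\<close>, whereas \<open>0 powr 0 = 0\<close>.\<close>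

definition rpow :: "real \<Rightarrow> real \<Rightarrow> real" where
  "rpow x a = (if a = 0 then 1 else x powr a)"

lemma measurable_sphere_proj:
  "(\<lambda>x::'a::euclidean_space. x /\<^sub>R norm x)
     \<in> measurable (restrict_space lborel (ball 0 1 - {0})) (restrict_space borel (sphere 0 1))"
  by (intro measurable_restrict_space3) (auto simp: space_restrict_space)

lemma emeasure_sphere_measure:
  fixes A :: "'a::euclidean_space set"
  assumes "A \<in> sets borel" "A \<subseteq> sphere 0 1"
  shows "emeasure sphere_measure A =
    of_nat DIM('a) * emeasure lborel {x \<in> ball 0 1 - {0}. x /\<^sub>R norm x \<in> A}"
proof -
  have A: "A \<in> sets (restrict_space borel (sphere 0 1))"
    using assms by (subst sets_restrict_space_iff) auto
  have eq: "(\<lambda>x::'a. x /\<^sub>R norm x) -` A \<inter> space (restrict_space lborel (ball 0 1 - {0}))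
      = {x \<in> ball 0 1 - {0}. x /\<^sub>R norm x \<in> A}"
    by (auto simp: space_restrict_space)
  show ?thesis
    unfolding sphere_measure_def emeasure_scale_measure
      emeasure_distr[OF measurable_sphere_proj A] eq
    by (subst emeasure_restrict_space) auto
qed

lemma emeasure_sphere_measure_total:
  "emeasure sphere_measure (sphere (0::'a::euclidean_space) 1)
     = of_nat DIM('a) * ennreal (unit_ball_vol (real DIM('a)))"
proof -
  have "{x \<in> ball (0::'a) 1 - {0}. x /\<^sub>R norm x \<in> sphere 0 1} = ball 0 1 - {0}"
    by auto
  moreover have "emeasure lborel (ball (0::'a) 1 - {0}) = emeasure lborel (ball (0::'a) 1)"
    by (rule emeasure_Diff_null_set) auto
  ultimately show ?thesis
    by (simp add: emeasure_sphere_measure emeasure_ball)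
qed

lemma emeasure_sphere_measure_dim1:
  fixes e :: "'a::euclidean_space"
  assumes "DIM('a) = 1" "norm e = 1"
  shows "emeasure sphere_measure {e} = 1"
proof -
  let ?P = "\<lambda>e::'a. {x \<in> ball 0 1 - {0}. x /\<^sub>R norm x = e}"
  obtain b :: 'a where b: "Basis = {b}"
    using assms(1) card_1_singletonE by blast
  have pm: "v = e \<or> v = - e" if "norm v = 1" for v :: 'a
  proof -
    have rep: "(w \<bullet> b) *\<^sub>R b = w" for w
      using euclidean_representation[of w] by (simp add: b)
    have "norm b = 1" by (rule norm_Basis) (simp add: b)
    then have "\<bar>w \<bullet> b\<bar> = norm w" for w
      using rep[of w] by (metis norm_scaleR mult.right_neutral)
    then have "\<bar>v \<bullet> b\<bar> = 1" "\<bar>e \<bullet> b\<bar> = 1"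
      using that assms(2) by auto
    then have "v \<bullet> b = e \<bullet> b \<or> v \<bullet> b = - (e \<bullet> b)" by linarith
    then show ?thesis
      using rep[of v] rep[of e] by (metis scaleR_minus_left)
  qed
  have msr: "{x \<in> ball 0 1 - {0}. x /\<^sub>R norm x = v} \<in> sets borel" for v :: 'a
    by measurable
  have ne: "e \<noteq> - e"
  proof
    assume "e = - e"
    then have "2 *\<^sub>R e = 0" by (metis add.right_inverse scaleR_2)
    then show False using assms(2) by auto
  qed
  have sph: "{e} \<union> {- e} = sphere 0 1" "{e} \<inter> {- e} = {}"
  proof -
    show "{e} \<union> {- e} = sphere 0 1"
    proof (intro equalityI subsetI)
      fix v assume "v \<in> sphere (0::'a) 1"
      then show "v \<in> {e} \<union> {- e}" using pm[of v] by (simp add: disj_commute)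
    qed (use assms(2) in auto)
    show "{e} \<inter> {- e} = {}" using ne by blast
  qed
  have neg: "emeasure lborel (?P (- e)) = emeasure lborel (?P e)"
  proof -
    have "- w = e \<longleftrightarrow> w = - e" for w
      by (metis minus_minus)
    then have "- x /\<^sub>R norm (- x) = e \<longleftrightarrow> x /\<^sub>R norm x = - e" for x
      by (simp only: norm_minus_cancel scaleR_minus_right)
    then have preimage: "uminus -` ?P e \<inter> space lborel = ?P (- e)"
      unfolding set_eq_iff by (simp del: scaleR_minus_right norm_minus_cancel)
        (simp only: norm_minus_cancel simp_thms)
    have "lborel = distr lborel borel (uminus :: 'a \<Rightarrow> 'a)"
      using lborel_affine[of "-1" "0::'a"] by (simp add: density_1)
    then have "emeasure lborel (?P e) = emeasure (distr lborel borel uminus) (?P e)"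
      by (rule arg_cong)
    also have "\<dots> = emeasure lborel (uminus -` ?P e \<inter> space lborel)"
      by (rule emeasure_distr) (use msr in auto)
    finally show ?thesis by (simp only: preimage)
  qed
  have m: "emeasure sphere_measure {v} = emeasure lborel (?P v)" if "norm v = 1" for v
    using emeasure_sphere_measure[of "{v}"] that assms(1) by simp
  have "2 = emeasure sphere_measure (sphere (0::'a) 1)"
    by (simp add: emeasure_sphere_measure_total assms(1))
  also have "\<dots> = emeasure sphere_measure ({e} \<union> {- e})" using sph by simp
  also have "\<dots> = emeasure sphere_measure {e} + emeasure sphere_measure {- e}"
  proof (rule plus_emeasure[symmetric])
    show "{e} \<in> sets sphere_measure" "{- e} \<in> sets sphere_measure"
      using assms(2) by (auto simp: sphere_measure_def sets_restrict_space_iff)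
  qed (use sph in auto)
  also have "\<dots> = 2 * emeasure sphere_measure {e}"
    using m[of e] m[of "- e"] neg assms(2) by (simp add: mult_2)
  finally have "2 * 1 = 2 * emeasure sphere_measure {e}" by simp
  then show ?thesis
    by (subst (asm) ennreal_mult_cancel_left) auto
qed

end

theory Submission
  imports Defs
begin

text \<open>
  The proof reduces the planar inequality to lines. In polar form, \<open>1 / D\<^sup>2\<close> is \<open>N\<close> times the
  mean over directions \<open>e\<close> of \<open>1 / d\<^sub>e\<^sup>2\<close>, and \<open>|\<nabla>f|\<^sup>2\<close> is the sum of \<open>(\<partial>\<^sub>e f)\<^sup>2\<close> over any orthonormal frame.
  So the energy is an average, over orthonormal frames, of sums of directional energies
  \<open>E\<^sub>e = \<integral> (\<partial>\<^sub>e f)\<^sup>2 - f\<^sup>2 / (4 d\<^sub>e\<^sup>2)\<close>, and \<open>E\<^sub>e\<close> is an integral of one-dimensional Hardy energies over the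
  lines parallel to \<open>e\<close>.

  On an interval, the substitution \<open>f = \<surd>t v\<close>, where \<open>t\<close> is the distance to the nearest end point, turns
  the Hardy energy into \<open>\<integral> t v'\<^sup>2\<close> plus a nonnegative term at the midpoint. What remains still bounds
  \<open>f\<close> uniformly: \<open>|f|\<^sup>m \<le> C (l A + E / l)\<close> for every \<open>l > 0\<close>, where \<open>A\<close> is the integral of
  \<open>f\<^sup>2\<^sup>m\<^sup>-\<^sup>2\<close> (\<open>hardy_interval\<close>). For an open subset of a line the bound follows because all its components
  have nonnegative energy (\<open>hardy_open_set\<close>). In dimension one the case \<open>m = 2\<close> gives
  \<open>|f|\<^sup>4 \<le> C E \<integral> f\<^sup>2\<close> after optimisation in \<open>l\<close>, and this implies the theorem.

  In the plane, one factor of \<open>f\<^sup>2\<^sup>m = |f|\<^sup>m |f|\<^sup>m\<close> is estimated along lines parallel to \<open>e\<close> and the other one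
  along lines orthogonal to \<open>e\<close>, as in Gagliardo's proof of the Sobolev inequality
  (\<open>planar_product_bound\<close>). With \<open>M = \<integral> f\<^sup>2\<^sup>m\<close> this reads \<open>\<surd>M \<le> C (l A + E' / l)\<close>, where \<open>E'\<close> is the sum
  of the two directional energies. The bound is linear in \<open>E'\<close>, so averaging
  over the frames replaces \<open>E'\<close> by the full energy \<open>E\<close>, and only then is \<open>l\<close> optimised: \<open>M \<le> C E A\<close>
  (\<open>hardy_planar\<close>). Interpolating \<open>A\<close> and \<open>\<integral> |f|\<^sup>q\<close> between \<open>M\<close> and \<open>\<integral> f\<^sup>2\<close> gives
  \<open>\<integral> |f|\<^sup>q \<le> C E\<^bsup>(q - 2) / 2\<^esup> \<integral> f\<^sup>2\<close> (\<open>gagliardo_nirenberg_planar_real\<close>). A complex function is treated through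
  its real and imaginary parts, whose energies and masses add up.
\<close>

section \<open>Hardy inequalities with remainder on an interval\<close>

text \<open>This takes the place of the Cauchy-Schwarz inequality. With the parameter \<open>l\<close> kept free, all later
estimates are linear in the energy and can be averaged over directions.\<close>

lemma abs_mult_le_weighted_squares:
  fixes a b l :: real
  assumes "l > 0"
  shows "\<bar>a * b\<bar> \<le> (l * a\<^sup>2 + b\<^sup>2 / l) / 2"
proof -
  have "0 \<le> (l * \<bar>a\<bar> - \<bar>b\<bar>)\<^sup>2 / l" using assms by simp
  also have "\<dots> = l * a\<^sup>2 + b\<^sup>2 / l - 2 * \<bar>a * b\<bar>"
    using assms by (simp add: power2_eq_square field_simps abs_mult)
  finally show ?thesis by simp
qed

lemma has_integral_abs_le:
  fixes f g :: "real \<Rightarrow> real"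
  assumes "(f has_integral i) S" "(g has_integral j) S" "\<And>x. x \<in> S \<Longrightarrow> \<bar>f x\<bar> \<le> g x"
  shows "\<bar>i\<bar> \<le> j"
  using integral_norm_bound_integral[of f S g] assms
  by (auto simp: has_integral_iff)

context
  fixes f f' :: "real \<Rightarrow> real" and d L :: real
  assumes d: "0 < d" "d \<le> L" and f0: "f d = 0"
    and deriv: "\<And>t. t \<in> {d..L} \<Longrightarrow> (f has_real_derivative f' t) (at t within {d..L})"
    and cont': "continuous_on {d..L} f'"
begin

private lemma cont: "continuous_on {d..L} f"
  using deriv by (meson DERIV_continuous continuous_on_eq_continuous_within)

text \<open>The function \<open>\<surd>t\<close> solves the Euler equation of the Hardy energy. For \<open>f = \<surd>t v\<close> one has
\<open>\<surd>t v' = f' - f / (2 t)\<close>, and the energy density exceeds the square of this by the derivative of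
\<open>f\<^sup>2 / (2 t)\<close>. The boundary term at \<open>L\<close> is what controls \<open>f\<close> at the midpoint of an interval.\<close>

lemma hardy_ground_state_identity:
  "integral {d..L} (\<lambda>t. (f' t)\<^sup>2 - (f t)\<^sup>2 / (4 * t\<^sup>2)) =
   integral {d..L} (\<lambda>t. (f' t - f t / (2 * t))\<^sup>2) + (f L)\<^sup>2 / (2 * L)"
proof -
  let ?w = "\<lambda>t. f' t - f t / (2 * t)"
  have "((\<lambda>t. f t * f' t / t - (f t)\<^sup>2 / (2 * t\<^sup>2)) has_integral
      (f L)\<^sup>2 / (2 * L) - (f d)\<^sup>2 / (2 * d)) {d..L}"
  proof (rule fundamental_theorem_of_calculus)
    fix t assume t: "t \<in> {d..L}"
    then have "t > 0" using d by auto
    with t show "((\<lambda>t. (f t)\<^sup>2 / (2 * t)) has_vector_derivative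
        f t * f' t / t - (f t)\<^sup>2 / (2 * t\<^sup>2)) (at t within {d..L})"
      unfolding has_real_derivative_iff_has_vector_derivative[symmetric]
      by (auto intro!: derivative_eq_intros deriv simp: field_simps power2_eq_square)
  qed (use d in auto)
  moreover have "((\<lambda>t. (?w t)\<^sup>2) has_integral integral {d..L} (\<lambda>t. (?w t)\<^sup>2)) {d..L}"
    using d by (intro integrable_integral integrable_continuous_interval continuous_intros cont cont') auto
  ultimately have "((\<lambda>t. (?w t)\<^sup>2 + (f t * f' t / t - (f t)\<^sup>2 / (2 * t\<^sup>2))) has_integral
      integral {d..L} (\<lambda>t. (?w t)\<^sup>2) + (f L)\<^sup>2 / (2 * L)) {d..L}"
    using f0 by (auto dest: has_integral_add)
  then have "((\<lambda>t. (f' t)\<^sup>2 - (f t)\<^sup>2 / (4 * t\<^sup>2)) has_integral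
      integral {d..L} (\<lambda>t. (?w t)\<^sup>2) + (f L)\<^sup>2 / (2 * L)) {d..L}"
    by (rule has_integral_eq[rotated]) (use d in \<open>auto simp: power2_eq_square field_simps\<close>)
  then show ?thesis by (rule integral_unique)
qed

text \<open>With \<open>w = f' - f / (2 t)\<close> and \<open>m = n + 1\<close>, the estimate comes from three derivatives:
\<open>(t f\<^sup>2)' = 2 f\<^sup>2 + 2 t f w\<close> bounds \<open>\<integral> f\<^sup>2\<close> by \<open>2 L\<^sup>2 E\<close>;
\<open>(t f\<^sup>m)' = (1 + m / 2) f\<^sup>m + m t f\<^sup>n w\<close> then bounds \<open>f\<close> at \<open>L\<close>; and
\<open>(t\<^bsup>-m/2\<^esup> f\<^sup>m)' = m t\<^bsup>-m/2\<^esup> f\<^sup>n w\<close> carries the bound from \<open>L\<close> down to \<open>t\<close>. The resulting constant does not depend on \<open>L\<close>.\<close>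

lemma hardy_half_interval:
  fixes n :: nat and l :: real
  assumes l: "l > 0"
  defines "A \<equiv> integral {d..L} (\<lambda>t. f t ^ (2 * n))"
    and "E \<equiv> integral {d..L} (\<lambda>t. (f' t)\<^sup>2 - (f t)\<^sup>2 / (4 * t\<^sup>2))"
  shows "E \<ge> 0"
    and "t \<in> {d..L} \<Longrightarrow> \<bar>f t\<bar> ^ Suc n \<le> (2 * n + 3) * (l * A + E / l)"
proof -
  define w where "w t = f' t - f t / (2 * t)" for t
  define m where "m = real (Suc n)"
  define P where "P = integral {d..L} (\<lambda>t. (w t)\<^sup>2)"
  define X where "X = integral {d..L} (\<lambda>t. (f t)\<^sup>2)"
  define B where "B = (f L)\<^sup>2 / (2 * L)"
  have L: "L > 0" using d by simp
  have pos: "t > 0" "t \<noteq> 0" if "t \<in> {d..L}" for t using that d by auto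
  have contw: "continuous_on {d..L} w"
    unfolding w_def using pos by (intro continuous_intros cont cont') auto
  note c = cont cont' contw
  have hP: "((\<lambda>t. (w t)\<^sup>2) has_integral P) {d..L}"
    unfolding P_def by (intro integrable_integral integrable_continuous_interval continuous_intros c)
  have hX: "((\<lambda>t. (f t)\<^sup>2) has_integral X) {d..L}"
    unfolding X_def by (intro integrable_integral integrable_continuous_interval continuous_intros c)
  have hA: "((\<lambda>t. f t ^ (2 * n)) has_integral A) {d..L}"
    unfolding A_def by (intro integrable_integral integrable_continuous_interval continuous_intros c)
  have P0: "P \<ge> 0" using hP by (rule has_integral_nonneg) auto
  have A0: "A \<ge> 0" using hA by (rule has_integral_nonneg) auto
  have B0: "B \<ge> 0" using L by (simp add: B_def)
  have E: "E = P + B"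
    unfolding E_def P_def B_def w_def by (rule hardy_ground_state_identity)
  then show E0: "E \<ge> 0" using P0 B0 by simp
  have m: "m \<ge> 1" "m > 0" by (auto simp: m_def)
  have lAE: "l * A + E / l \<ge> 0" using l A0 E0 by auto

  have half: "x / 2 \<le> x" if "x \<ge> 0" for x :: real using that by simp

  have X_le: "X \<le> 2 * L\<^sup>2 * E"
  proof -
    have *: "((\<lambda>t. 2 * (f t)\<^sup>2 + 2 * t * f t * w t) has_integral L * (f L)\<^sup>2 - d * (f d)\<^sup>2) {d..L}"
    proof (rule fundamental_theorem_of_calculus)
      fix t assume t: "t \<in> {d..L}"
      with pos[OF t] show "((\<lambda>t. t * (f t)\<^sup>2) has_vector_derivative
          2 * (f t)\<^sup>2 + 2 * t * f t * w t) (at t within {d..L})"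
        unfolding has_real_derivative_iff_has_vector_derivative[symmetric] w_def
        by (auto intro!: derivative_eq_intros deriv simp: field_simps power2_eq_square)
    qed (use d in auto)
    have "((\<lambda>t. 2 * (f t)\<^sup>2 - ((f t)\<^sup>2 + L\<^sup>2 * (w t)\<^sup>2)) has_integral
        2 * X - (X + L\<^sup>2 * P)) {d..L}"
      by (intro has_integral_diff has_integral_add has_integral_mult_right hX hP)
    then have "2 * X - (X + L\<^sup>2 * P) \<le> L * (f L)\<^sup>2 - d * (f d)\<^sup>2" using *
    proof (rule has_integral_le)
      fix t assume t: "t \<in> {d..L}"
      have "t\<^sup>2 * (w t)\<^sup>2 \<le> L\<^sup>2 * (w t)\<^sup>2"
        using t pos[OF t] by (intro mult_right_mono power_mono) auto
      moreover have "0 \<le> (f t + t * w t)\<^sup>2" by simp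
      ultimately show "2 * (f t)\<^sup>2 - ((f t)\<^sup>2 + L\<^sup>2 * (w t)\<^sup>2) \<le> 2 * (f t)\<^sup>2 + 2 * t * f t * w t"
        by (simp add: power2_eq_square algebra_simps)
    qed
    moreover have "L * (f L)\<^sup>2 = 2 * L\<^sup>2 * B" using L by (simp add: B_def power2_eq_square)
    moreover have "0 \<le> L\<^sup>2 * P" using P0 by simp
    ultimately show ?thesis unfolding E f0 by (simp add: algebra_simps)
  qed

  have midpoint: "\<bar>f L\<bar> ^ Suc n \<le> (1 + m) * (l * A + E / l)"
  proof -
    have "((\<lambda>t. (1 + m / 2) * f t ^ Suc n + m * t * f t ^ n * w t) has_integral
        L * f L ^ Suc n - d * f d ^ Suc n) {d..L}"
    proof (rule fundamental_theorem_of_calculus)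
      fix t assume t: "t \<in> {d..L}"
      with pos[OF t] show "((\<lambda>t. t * f t ^ Suc n) has_vector_derivative
          (1 + m / 2) * f t ^ Suc n + m * t * f t ^ n * w t) (at t within {d..L})"
        unfolding has_real_derivative_iff_has_vector_derivative[symmetric] w_def m_def
        by (auto intro!: derivative_eq_intros deriv simp del: power_Suc simp add: field_simps)
          (simp add: field_simps)
    qed (use d in auto)
    moreover have "((\<lambda>t. (1 + m / 2) * ((l * L * f t ^ (2 * n) + (f t)\<^sup>2 / (l * L)) / 2)
          + m * L * ((l * f t ^ (2 * n) + (w t)\<^sup>2 / l) / 2)) has_integral
        (1 + m / 2) * ((l * L * A + X / (l * L)) / 2) + m * L * ((l * A + P / l) / 2)) {d..L}"
      by (intro has_integral_add has_integral_mult_right has_integral_divide hX hP hA)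
    ultimately have "norm (L * f L ^ Suc n - d * f d ^ Suc n) \<le>
      (1 + m / 2) * ((l * L * A + X / (l * L)) / 2) + m * L * ((l * A + P / l) / 2)"
    proof (rule has_integral_abs_le[unfolded real_norm_def[symmetric]])
      fix t assume t: "t \<in> {d..L}"
      have "norm ((1 + m / 2) * f t ^ Suc n + m * t * f t ^ n * w t)
          \<le> (1 + m / 2) * \<bar>f t ^ n * f t\<bar> + m * t * \<bar>f t ^ n * w t\<bar>"
        using m pos[OF t] unfolding real_norm_def
        by (intro order_trans[OF abs_triangle_ineq]) (simp add: abs_mult)
      also have "\<dots> \<le> (1 + m / 2) * ((l * L * f t ^ (2 * n) + (f t)\<^sup>2 / (l * L)) / 2)
          + m * L * ((l * f t ^ (2 * n) + (w t)\<^sup>2 / l) / 2)"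
        using abs_mult_le_weighted_squares[of "l * L" "f t ^ n" "f t"]
          abs_mult_le_weighted_squares[OF l, of "f t ^ n" "w t"] l L m t pos[OF t]
        by (intro add_mono mult_mono) (auto simp: power_even_eq)
      finally show "norm ((1 + m / 2) * f t ^ Suc n + m * t * f t ^ n * w t) \<le> \<dots>" .
    qed
    also have "L * f L ^ Suc n - d * f d ^ Suc n = L * f L ^ Suc n" by (simp add: f0)
    also have "(1 + m / 2) * ((l * L * A + X / (l * L)) / 2) + m * L * ((l * A + P / l) / 2)
       \<le> (1 + m / 2) * (L * (l * A + 2 * (E / l)) / 2) + m * L * ((l * A + E / l) / 2)"
    proof -
      have "X / (l * L) \<le> 2 * L * (E / l)"
        using X_le l L by (simp add: field_simps power2_eq_square)
      then have "l * L * A + X / (l * L) \<le> L * (l * A + 2 * (E / l))"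
        by (simp add: algebra_simps)
      moreover have "l * A + P / l \<le> l * A + E / l" using l B0 E by (simp add: divide_right_mono)
      moreover have "0 \<le> 1 + m / 2" "0 \<le> m * L" using m L by auto
      ultimately show ?thesis
        by (intro add_mono[OF mult_left_mono[OF divide_right_mono] mult_left_mono[OF divide_right_mono]]) auto
    qed
    also have "\<dots> \<le> L * ((1 + m) * (l * A + E / l))"
    proof -
      have "L * ((1 + m) * (y + z)) - ((1 + m / 2) * (L * (y + 2 * z) / 2) + m * L * ((y + z) / 2))
          = L * y * (1 / 2 + m / 4)" for y z :: real
        by (simp add: field_simps)
      from this[of "l * A" "E / l"] show ?thesis
        using m L l A0 by (smt (verit) divide_nonneg_pos mult_nonneg_nonneg)
    qed
    finally show ?thesis using L by (simp add: abs_mult power_abs)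
  qed
  show "\<bar>f t\<bar> ^ Suc n \<le> (2 * n + 3) * (l * A + E / l)" if t: "t \<in> {d..L}"
  proof -
    have t0: "t > 0" using pos t by auto
    have sub: "{t..L} \<subseteq> {d..L}" using t by auto
    have "((\<lambda>s. m * s powr (- m / 2) * (f s ^ n * w s)) has_integral
        L powr (- m / 2) * f L ^ Suc n - t powr (- m / 2) * f t ^ Suc n) {t..L}"
    proof (rule fundamental_theorem_of_calculus)
      fix s assume s: "s \<in> {t..L}"
      have s': "s > 0" "s \<in> {d..L}" using s t0 sub by auto
      have "(f has_real_derivative f' s) (at s within {t..L})"
        using deriv[OF s'(2)] sub by (rule DERIV_subset)
      then have 1: "((\<lambda>s. f s ^ Suc n) has_real_derivative m * f s ^ n * f' s) (at s within {t..L})"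
        unfolding m_def by (auto intro!: derivative_eq_intros simp del: power_Suc)
      have 2: "((\<lambda>s. s powr (- m / 2)) has_real_derivative
          - m / 2 * (s powr (- m / 2) / s)) (at s within {t..L})"
        using has_real_derivative_powr[OF s'(1), of "- m / 2"] s'
        by (auto intro!: has_field_derivative_at_within simp: powr_diff)
      show "((\<lambda>s. s powr (- m / 2) * f s ^ Suc n) has_vector_derivative
          m * s powr (- m / 2) * (f s ^ n * w s)) (at s within {t..L})"
        unfolding has_real_derivative_iff_has_vector_derivative[symmetric]
        by (rule DERIV_cong[OF DERIV_mult[OF 2 1]]) (use s' in \<open>simp add: w_def field_simps\<close>)
    qed (use t in auto)
    moreover have "((\<lambda>s. m * t powr (- m / 2) * ((l * f s ^ (2 * n) + (w s)\<^sup>2 / l) / 2))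
        has_integral m * t powr (- m / 2) * integral {t..L} (\<lambda>s. (l * f s ^ (2 * n) + (w s)\<^sup>2 / l) / 2)) {t..L}"
      using sub l by (intro has_integral_mult_right integrable_integral integrable_continuous_interval
          continuous_intros c[THEN continuous_on_subset]) auto
    ultimately have "\<bar>L powr (- m / 2) * f L ^ Suc n - t powr (- m / 2) * f t ^ Suc n\<bar>
        \<le> m * t powr (- m / 2) * integral {t..L} (\<lambda>s. (l * f s ^ (2 * n) + (w s)\<^sup>2 / l) / 2)"
    proof (rule has_integral_abs_le)
      fix s assume s: "s \<in> {t..L}"
      have "s powr (- m / 2) \<le> t powr (- m / 2)"
        using s t0 m by (intro powr_mono2') auto
      then show "\<bar>m * s powr (- m / 2) * (f s ^ n * w s)\<bar>
          \<le> m * t powr (- m / 2) * ((l * f s ^ (2 * n) + (w s)\<^sup>2 / l) / 2)"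
        using abs_mult_le_weighted_squares[OF l, of "f s ^ n" "w s"] m
        unfolding abs_mult[of "m * _"] by (intro mult_mono) (auto simp: abs_mult power_even_eq)
    qed
    also have "\<dots> \<le> t powr (- m / 2) * (m * ((l * A + E / l) / 2))"
    proof -
      have h: "((\<lambda>s. (l * f s ^ (2 * n) + (w s)\<^sup>2 / l) / 2) has_integral (l * A + P / l) / 2) {d..L}"
        by (intro has_integral_add has_integral_mult_right has_integral_divide hP hA)
      have "integral {t..L} (\<lambda>s. (l * f s ^ (2 * n) + (w s)\<^sup>2 / l) / 2)
          \<le> integral {d..L} (\<lambda>s. (l * f s ^ (2 * n) + (w s)\<^sup>2 / l) / 2)"
      proof (rule integral_subset_le[OF sub])
        show "(\<lambda>s. (l * f s ^ (2 * n) + (w s)\<^sup>2 / l) / 2) integrable_on {t..L}"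
          using sub l by (intro integrable_continuous_interval
            continuous_intros c[THEN continuous_on_subset]) auto
      qed (use h l in \<open>auto simp only: has_integral_iff\<close>, auto)
      also have "\<dots> = (l * A + P / l) / 2" using h by (rule integral_unique)
      also have "\<dots> \<le> (l * A + E / l) / 2"
        using l B0 E by (simp add: divide_right_mono)
      finally have "m * t powr (- m / 2) * integral {t..L} (\<lambda>s. (l * f s ^ (2 * n) + (w s)\<^sup>2 / l) / 2)
          \<le> m * t powr (- m / 2) * ((l * A + E / l) / 2)"
        using m by (intro mult_left_mono) auto
      then show ?thesis by (simp only: mult.assoc mult.left_commute[of m])
    qed
    finally have "\<bar>t powr (- m / 2) * f t ^ Suc n\<bar>
        \<le> \<bar>L powr (- m / 2) * f L ^ Suc n\<bar> + t powr (- m / 2) * (m * ((l * A + E / l) / 2))"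
      by linarith
    then have "t powr (- m / 2) * \<bar>f t ^ Suc n\<bar>
        \<le> L powr (- m / 2) * \<bar>f L ^ Suc n\<bar> + t powr (- m / 2) * (m * ((l * A + E / l) / 2))"
      by (simp only: abs_mult abs_of_nonneg[OF powr_ge_zero])
    also have "\<dots> \<le> t powr (- m / 2) * \<bar>f L ^ Suc n\<bar> + t powr (- m / 2) * (m * ((l * A + E / l) / 2))"
      using t t0 m lAE by (intro add_mono mult_right_mono powr_mono2') auto
    finally have "\<bar>f t ^ Suc n\<bar> \<le> \<bar>f L ^ Suc n\<bar> + m * ((l * A + E / l) / 2)"
      unfolding distrib_left[symmetric] using t0 by (subst (asm) mult_le_cancel_left_pos) auto
    also have "\<dots> \<le> (1 + m) * (l * A + E / l) + m * (l * A + E / l)"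
    proof (rule add_mono)
      show "\<bar>f L ^ Suc n\<bar> \<le> (1 + m) * (l * A + E / l)" using midpoint by (simp only: power_abs)
      show "m * ((l * A + E / l) / 2) \<le> m * (l * A + E / l)" using m(2) half[OF lAE] by (intro mult_left_mono) auto
    qed
    finally show ?thesis by (simp add: m_def power_abs[symmetric] algebra_simps)
  qed
qed

end

context
  fixes f f' :: "real \<Rightarrow> real"
  assumes deriv: "\<And>t. (f has_real_derivative f' t) (at t)"
    and cont': "continuous_on UNIV f'"
begin

private lemma cont_f: "continuous_on S f"
  using deriv by (meson DERIV_continuous_on has_field_derivative_at_within)

text \<open>The interval is cut at its midpoint, where the nearest end point changes. The right half becomes a
left half by reflection; both halves have nonnegative energy, so each is bounded by the whole.\<close>

lemma hardy_interval:
  fixes n :: nat and a b d l :: real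
  assumes d: "0 < d" "a + d \<le> b - d" and f0: "f (a + d) = 0" "f (b - d) = 0" and l: "l > 0"
  defines "A \<equiv> integral {a + d..b - d} (\<lambda>t. f t ^ (2 * n))"
    and "E \<equiv> integral {a + d..b - d} (\<lambda>t. (f' t)\<^sup>2 - (f t)\<^sup>2 / (4 * (min (t - a) (b - t))\<^sup>2))"
  shows "E \<ge> 0"
    and "t \<in> {a + d..b - d} \<Longrightarrow> \<bar>f t\<bar> ^ Suc n \<le> (2 * n + 3) * (l * A + E / l)"
proof -
  define c where "c = (a + b) / 2"
  define L where "L = (b - a) / 2"
  define h where "h t = (f' t)\<^sup>2 - (f t)\<^sup>2 / (4 * (min (t - a) (b - t))\<^sup>2)" for t
  have c: "a + d \<le> c" "c \<le> b - d" and dL: "d \<le> L" using d by (auto simp: c_def L_def)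
  have conth: "continuous_on {a + d..b - d} h"
    unfolding h_def using d
    by (intro continuous_intros cont_f continuous_on_subset[OF cont']) (auto simp: min_def)
  define EL where "EL = integral {a + d..c} h"
  define ER where "ER = integral {c..b - d} h"
  define AL where "AL = integral {a + d..c} (\<lambda>t. f t ^ (2 * n))"
  define AR where "AR = integral {c..b - d} (\<lambda>t. f t ^ (2 * n))"
  have E: "E = EL + ER"
    unfolding E_def EL_def ER_def h_def[symmetric]
    by (rule Henstock_Kurzweil_Integration.integral_combine[symmetric]) (use c integrable_continuous_interval[OF conth] in auto)
  have A: "A = AL + AR"
    unfolding A_def AL_def AR_def
    by (rule Henstock_Kurzweil_Integration.integral_combine[symmetric])
      (use c in \<open>auto intro!: integrable_continuous_interval continuous_intros cont_f\<close>)
  have A0: "AL \<ge> 0" "AR \<ge> 0"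
    unfolding AL_def AR_def
    by (auto intro!: integral_nonneg integrable_continuous_interval continuous_intros cont_f)

  have EL: "EL = integral {d..L} (\<lambda>t. (f' (t + a))\<^sup>2 - (f (t + a))\<^sup>2 / (4 * t\<^sup>2))"
  proof -
    have "EL = integral {d..L} (\<lambda>t. h (t + a))"
      unfolding EL_def integral_shift_real_ivl[of "a + d" a c h, symmetric]
      by (simp add: c_def L_def field_simps)
    also have "\<dots> = integral {d..L} (\<lambda>t. (f' (t + a))\<^sup>2 - (f (t + a))\<^sup>2 / (4 * t\<^sup>2))"
      by (rule integral_cong) (auto simp: h_def L_def min_def)
    finally show ?thesis .
  qed
  have AL: "AL = integral {d..L} (\<lambda>t. f (t + a) ^ (2 * n))"
    unfolding AL_def integral_shift_real_ivl[of "a + d" a c, symmetric]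
    by (simp add: c_def L_def field_simps)
  have reflect: "integral {c..b - d} g = integral {d..L} (\<lambda>t. g (b - t))" for g :: "real \<Rightarrow> real"
  proof -
    have "integral {c..b - d} g = integral {-(b - d)..-c} (\<lambda>x. g (- x))"
      by (rule Henstock_Kurzweil_Integration.integral_reflect_real[symmetric])
    also have "\<dots> = integral {-(b - d) - (-b)..-c - (-b)} (\<lambda>x. g (- (x + (-b))))"
      by (rule integral_shift_real_ivl[symmetric])
    also have "\<dots> = integral {d..L} (\<lambda>t. g (b - t))"
      by (rule arg_cong2[where f = integral]) (auto simp: c_def L_def field_simps)
    finally show ?thesis .
  qed
  have ER: "ER = integral {d..L} (\<lambda>t. (- f' (b - t))\<^sup>2 - (f (b - t))\<^sup>2 / (4 * t\<^sup>2))"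
    unfolding ER_def reflect by (rule integral_cong) (simp add: h_def L_def min_absorb2)
  have AR: "AR = integral {d..L} (\<lambda>t. f (b - t) ^ (2 * n))"
    unfolding AR_def by (rule reflect)

  have left: "((\<lambda>t. f (t + a)) has_real_derivative f' (t + a)) (at t within S)" for t S
    using DERIV_shift[of f "f' (t + a)" t a] deriv has_field_derivative_at_within by blast
  have right: "((\<lambda>t. f (b - t)) has_real_derivative - f' (b - t)) (at t within S)" for t S
  proof -
    have "((\<lambda>t. b - t) has_real_derivative - 1) (at t within S)"
      by (auto intro!: derivative_eq_intros)
    from DERIV_chain[OF deriv this] show ?thesis by (simp add: o_def)
  qed
  have cl: "continuous_on S (\<lambda>t. f' (t + a))" and cr: "continuous_on S (\<lambda>t. - f' (b - t))" for S
    by (auto intro!: continuous_intros continuous_on_compose2[OF cont'])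
  have fl: "f (d + a) = 0" "f (b - d) = 0" using f0 by (auto simp: add.commute)
  have EL0: "EL \<ge> 0" and ER0: "ER \<ge> 0"
    unfolding EL ER
    by (rule hardy_half_interval(1)[OF d(1) dL _ _ _ l]; use fl left right cl cr in simp)+
  note L = hardy_half_interval(2)[of d L "\<lambda>t. f (t + a)" "\<lambda>t. f' (t + a)",
      OF d(1) dL fl(1) left cl l, where n = n, folded EL AL]
  note R = hardy_half_interval(2)[of d L "\<lambda>t. f (b - t)" "\<lambda>t. - f' (b - t)",
      OF d(1) dL fl(2) right cr l, where n = n, folded ER AR]
  show "E \<ge> 0" using EL0 ER0 E by simp
  have le: "l * AL + EL / l \<le> l * A + E / l" "l * AR + ER / l \<le> l * A + E / l"
    unfolding A E using A0 EL0 ER0 l by (auto intro!: add_mono divide_right_mono)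
  show "\<bar>f t\<bar> ^ Suc n \<le> (2 * n + 3) * (l * A + E / l)" if t: "t \<in> {a + d..b - d}"
  proof (cases "t \<le> c")
    case True
    then have "\<bar>f t\<bar> ^ Suc n \<le> (2 * n + 3) * (l * AL + EL / l)"
      using L[of "t - a"] t by (simp add: c_def L_def field_simps)
    also have "\<dots> \<le> (2 * n + 3) * (l * A + E / l)" using le by (intro mult_left_mono) auto
    finally show ?thesis .
  next
    case False
    then have "\<bar>f t\<bar> ^ Suc n \<le> (2 * n + 3) * (l * AR + ER / l)"
      using R[of "b - t"] t by (simp add: c_def L_def field_simps)
    also have "\<dots> \<le> (2 * n + 3) * (l * A + E / l)" using le by (intro mult_left_mono) auto
    finally show ?thesis .
  qed
qed

end

section \<open>Open subsets of the line\<close>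

lemma integrable_lborel_bounded_compact_support:
  fixes g :: "'a::euclidean_space \<Rightarrow> real"
  assumes "g \<in> borel_measurable borel" "compact K" "\<And>x. x \<in> K \<Longrightarrow> \<bar>g x\<bar> \<le> B" "\<And>x. x \<notin> K \<Longrightarrow> g x = 0"
  shows "integrable lborel g"
  using emeasure_compact_finite[OF assms(2)]
  by (intro integrableI_bounded_set[where A = K and B = B]) (use assms in \<open>auto simp: borel_compact\<close>)

lemma integrable_lborel_continuous_compact_support:
  fixes g :: "'a::euclidean_space \<Rightarrow> real"
  assumes "continuous_on UNIV g" "compact K" "\<And>x. x \<notin> K \<Longrightarrow> g x = 0"
  shows "integrable lborel g"
proof -
  have "bounded (g ` K)"
    using assms by (meson compact_continuous_image compact_imp_bounded continuous_on_subset subset_UNIV)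
  then obtain B where "\<And>x. x \<in> K \<Longrightarrow> \<bar>g x\<bar> \<le> B" by (auto simp: bounded_real)
  then show ?thesis
    using assms by (intro integrable_lborel_bounded_compact_support[of g K B])
      (auto intro: borel_measurable_continuous_onI)
qed

lemma open_connected_bounded_real_eq_interval:
  fixes C :: "real set"
  assumes "open C" "connected C" "bounded C" "C \<noteq> {}"
  obtains a b where "C = {a<..<b}"
proof
  have bdd: "bdd_above C" "bdd_below C"
    using assms(3) by (auto intro: bounded_imp_bdd_above bounded_imp_bdd_below)
  have Sup: "Sup C \<notin> C"
  proof
    assume "Sup C \<in> C"
    then obtain e where "e > 0" "ball (Sup C) e \<subseteq> C" using assms(1) openE by blast
    then have "Sup C + e / 2 \<in> C" by (auto simp: dist_real_def subset_iff)
    then show False using cSup_upper[OF _ bdd(1)] \<open>e > 0\<close> by fastforce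
  qed
  have Inf: "Inf C \<notin> C"
  proof
    assume "Inf C \<in> C"
    then obtain e where "e > 0" "ball (Inf C) e \<subseteq> C" using assms(1) openE by blast
    then have "Inf C - e / 2 \<in> C" by (auto simp: dist_real_def subset_iff)
    then show False using cInf_lower[OF _ bdd(2)] \<open>e > 0\<close> by fastforce
  qed
  show "C = {Inf C<..<Sup C}"
  proof (intro equalityI subsetI)
    fix x assume "x \<in> C"
    then show "x \<in> {Inf C<..<Sup C}"
      using cSup_upper[OF _ bdd(1)] cInf_lower[OF _ bdd(2)] Sup Inf by (auto simp: less_le)
  next
    fix x assume "x \<in> {Inf C<..<Sup C}"
    then obtain y z where "y \<in> C" "y < x" "z \<in> C" "x < z"
      using cInf_less_iff[OF assms(4) bdd(2)] less_cSup_iff[OF assms(4) bdd(1)] by auto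
    then show "x \<in> C"
      using assms(2) by (meson connected_iff_interval less_imp_le)
  qed
qed

context
  fixes f f' k :: "real \<Rightarrow> real" and K U :: "real set"
  assumes deriv: "\<And>t. (f has_real_derivative f' t) (at t)"
    and cont': "continuous_on UNIV f'"
    and K: "compact K" "K \<subseteq> U" "\<And>t. t \<notin> K \<Longrightarrow> f t = 0"
    and U: "open U"
    and k: "\<And>t \<rho>. t \<in> K \<Longrightarrow> 0 < \<rho> \<Longrightarrow> {t - \<rho><..<t + \<rho>} \<subseteq> U \<Longrightarrow> k t \<le> 1 / \<rho>\<^sup>2"
    and int_k: "integrable lborel (\<lambda>t. (f t)\<^sup>2 * k t)"
begin

private lemma cont_on_f: "continuous_on S f"
  using deriv by (meson DERIV_continuous_on has_field_derivative_at_within)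

private lemma f'_eq_0: "f' t = 0" if "t \<notin> K"
proof -
  have "open (- K)" using K(1) by (simp add: compact_imp_closed open_Compl)
  then have "((\<lambda>_. 0) has_real_derivative f' t) (at t)"
    using has_field_derivative_transform_within_open[OF deriv, of "- K" t "\<lambda>_. 0"] that K(3) by auto
  then show ?thesis by (rule DERIV_unique) auto
qed

private abbreviation (input) "h \<equiv> \<lambda>t. (f' t)\<^sup>2 - (f t)\<^sup>2 * k t / 4"

private lemma int_h: "integrable lborel h"
proof (rule Bochner_Integration.integrable_diff)
  show "integrable lborel (\<lambda>t. (f' t)\<^sup>2)"
    by (rule integrable_lborel_continuous_compact_support[OF _ K(1)]) (auto intro!: continuous_intros cont' simp: f'_eq_0)
  show "integrable lborel (\<lambda>t. (f t)\<^sup>2 * k t / 4)" using int_k by simp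
qed

text \<open>On the support, \<open>k\<close> is at most the inverse square of the distance to the nearer end point. Since the part of \<open>K\<close>
inside the interval is compact, \<open>f\<close> vanishes near both ends.\<close>

private lemma hardy_subinterval:
  fixes a b l :: real and n :: nat
  assumes ab: "{a<..<b} \<subseteq> U" and comp: "compact (K \<inter> {a<..<b})" and l: "l > 0" and n: "n > 0"
  shows "0 \<le> (LINT t:{a<..<b}|lborel. h t)"
    and "t \<in> {a<..<b} \<Longrightarrow> \<bar>f t\<bar> ^ Suc n \<le>
      (2 * n + 3) * (l * (LINT t:{a<..<b}|lborel. f t ^ (2 * n)) + (LINT t:{a<..<b}|lborel. h t) / l)"
proof -
  define I where "I = K \<inter> {a<..<b}"
  have "0 \<le> (LINT t:{a<..<b}|lborel. h t) \<and> (t \<in> {a<..<b} \<longrightarrow> \<bar>f t\<bar> ^ Suc n \<le>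
    (2 * n + 3) * (l * (LINT t:{a<..<b}|lborel. f t ^ (2 * n)) + (LINT t:{a<..<b}|lborel. h t) / l))"
  proof (cases "I = {}")
    case True
    then have "f t = 0" "f' t = 0" if "t \<in> {a<..<b}" for t
      using that K(3)[of t] f'_eq_0[of t] by (auto simp: I_def disjoint_iff)
    then have "(LINT t:{a<..<b}|lborel. h t) = 0" "(LINT t:{a<..<b}|lborel. f t ^ (2 * n)) = 0"
      unfolding set_lebesgue_integral_def using n
      by (auto intro!: integral_eq_zero_AE simp: indicator_def)
    with \<open>\<And>t. t \<in> {a<..<b} \<Longrightarrow> f t = 0\<close> show ?thesis by auto
  next
    case False
    obtain p where p: "p \<in> I" "\<And>s. s \<in> I \<Longrightarrow> p \<le> s"
      using compact_attains_inf[OF comp[folded I_def] False] by blast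
    obtain r where r: "r \<in> I" "\<And>s. s \<in> I \<Longrightarrow> s \<le> r"
      using compact_attains_sup[OF comp[folded I_def] False] by blast
    define d where "d = min (p - a) (b - r) / 2"
    have pr: "a < p" "p \<le> r" "r < b" using p r by (auto simp: I_def)
    have d: "0 < d" "a + d < p" "r < b - d" using pr by (auto simp: d_def min_def field_simps)
    have dJ: "a + d \<le> b - d" using d pr by auto
    have IJ: "I \<subseteq> {a + d..b - d}" using p r d by force
    have JI: "{a + d..b - d} \<subseteq> {a<..<b}" using d by auto
    have out: "t \<notin> K" if "t \<in> {a<..<b}" "t \<notin> {a + d<..<b - d}" for t
      using that p(2)[of t] r(2)[of t] d unfolding I_def by fastforce
    have f0: "f (a + d) = 0" "f (b - d) = 0"
      using out[of "a + d"] out[of "b - d"] d dJ K(3) by auto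
    have restrict: "(LINT t:{a<..<b}|lborel. g t) = (LINT t:{a + d..b - d}|lborel. g t)"
      if "\<And>t. t \<notin> K \<Longrightarrow> g t = 0" for g :: "real \<Rightarrow> real"
      unfolding set_lebesgue_integral_def
      by (rule Bochner_Integration.integral_cong)
        (use out that JI d in \<open>auto simp: indicator_def\<close>)
    let ?h0 = "\<lambda>t. (f' t)\<^sup>2 - (f t)\<^sup>2 / (4 * (min (t - a) (b - t))\<^sup>2)"
    have int_h0: "set_integrable lborel {a + d..b - d} ?h0"
      using d by (intro borel_integrable_atLeastAtMost' continuous_intros cont_on_f
         continuous_on_subset[OF cont']) (auto simp: min_def)
    have "integral {a + d..b - d} ?h0 = (LINT t:{a + d..b - d}|lborel. ?h0 t)"
      using set_borel_integral_eq_integral(2)[OF int_h0] by simp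
    also have "\<dots> \<le> (LINT t:{a + d..b - d}|lborel. h t)"
    proof (rule set_integral_mono[OF int_h0])
      show "set_integrable lborel {a + d..b - d} h"
        unfolding set_integrable_def by (rule integrable_mult_indicator) (use int_h in auto)
      fix t assume t: "t \<in> {a + d..b - d}"
      show "?h0 t \<le> h t"
      proof (cases "t \<in> K")
        case True
        have "{t - min (t - a) (b - t)<..<t + min (t - a) (b - t)} \<subseteq> {a<..<b}"
          by (auto simp: min_def split: if_splits)
        then have "k t \<le> 1 / (min (t - a) (b - t))\<^sup>2"
          using t d ab by (intro k[OF True]) auto
        then have "(f t)\<^sup>2 * k t \<le> (f t)\<^sup>2 * (1 / (min (t - a) (b - t))\<^sup>2)"
          by (rule mult_left_mono) auto
        then show ?thesis by simp
      qed (use K(3) in auto)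
    qed
    also have "\<dots> = (LINT t:{a<..<b}|lborel. h t)"
      by (rule restrict[symmetric]) (use K(3) f'_eq_0 in auto)
    finally have E: "integral {a + d..b - d} ?h0 \<le> (LINT t:{a<..<b}|lborel. h t)" .
    have "set_integrable lborel {a + d..b - d} (\<lambda>t. f t ^ (2 * n))"
      by (intro borel_integrable_atLeastAtMost' continuous_intros cont_on_f)
    then have A: "integral {a + d..b - d} (\<lambda>t. f t ^ (2 * n)) = (LINT t:{a<..<b}|lborel. f t ^ (2 * n))"
      using restrict[of "\<lambda>t. f t ^ (2 * n)"] K(3) n set_borel_integral_eq_integral(2) by fastforce
    note H = hardy_interval[OF deriv cont' d(1) dJ f0 l]
    have "\<bar>f t\<bar> ^ Suc n \<le> (2 * n + 3) * (l * (LINT t:{a<..<b}|lborel. f t ^ (2 * n)) +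
        (LINT t:{a<..<b}|lborel. h t) / l)" if t: "t \<in> {a<..<b}"
    proof (cases "t \<in> K")
      case True
      then have "t \<in> {a + d..b - d}" using t IJ by (auto simp: I_def)
      from H(2)[OF this, of n] have "\<bar>f t\<bar> ^ Suc n \<le> (2 * n + 3) *
        (l * (LINT t:{a<..<b}|lborel. f t ^ (2 * n)) + integral {a + d..b - d} ?h0 / l)"
        unfolding A .
      also have "\<dots> \<le> (2 * n + 3) * (l * (LINT t:{a<..<b}|lborel. f t ^ (2 * n)) +
        (LINT t:{a<..<b}|lborel. h t) / l)"
        using E l by (intro mult_left_mono add_mono divide_right_mono) auto
      finally show ?thesis .
    next
      case False
      have "0 \<le> (LINT t:{a<..<b}|lborel. f t ^ (2 * n))"
        unfolding set_lebesgue_integral_def by (rule integral_nonneg_AE) auto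
      then show ?thesis using False K(3) H(1) E l by auto
    qed
    then show ?thesis using H(1) E by auto
  qed
  then show "0 \<le> (LINT t:{a<..<b}|lborel. h t)"
    and "t \<in> {a<..<b} \<Longrightarrow> \<bar>f t\<bar> ^ Suc n \<le>
      (2 * n + 3) * (l * (LINT t:{a<..<b}|lborel. f t ^ (2 * n)) + (LINT t:{a<..<b}|lborel. h t) / l)"
    by blast+
qed

text \<open>Replacing \<open>U\<close> by its intersection with a large bounded interval keeps the hypothesis on \<open>k\<close> and makes all
components bounded intervals. By compactness only finitely many of them meet the support, so that
the energy is a finite sum of nonnegative contributions, one of which bounds \<open>f t\<close>.\<close>

lemma hardy_open_set:
  fixes l :: real and n :: nat
  assumes l: "l > 0" and n: "n > 0"
  shows "0 \<le> (LINT t|lborel. h t)"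
    and "\<bar>f t\<bar> ^ Suc n \<le> (2 * n + 3) * (l * (LINT t|lborel. f t ^ (2 * n)) + (LINT t|lborel. h t) / l)"
proof -
  obtain M where M: "K \<subseteq> {-M<..<M}"
  proof -
    obtain M where "\<forall>x\<in>K. \<bar>x\<bar> \<le> M" using compact_imp_bounded[OF K(1)] by (auto simp: bounded_real)
    then show ?thesis using that[of "M + 1"] by force
  qed
  define V where "V = U \<inter> {-M<..<M}"
  have V: "open V" "bounded V" "K \<subseteq> V" "V \<subseteq> U"
    using U M K(2) by (auto simp: V_def intro: bounded_subset[of "{-M<..<M}"])
  define \<C> where "\<C> = {C \<in> components V. C \<inter> K \<noteq> {}}"
  have opn: "open C" if "C \<in> components V" for C using open_components[OF V(1) that] .
  have disj: "C \<inter> D = {}" if "C \<in> components V" "D \<in> components V" "C \<noteq> D" for C D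
    using pairwise_disjoint_components[of V] that by (auto simp: pairwise_def)
  have cover: "\<Union>(components V) = V" by simp
  have fin: "finite \<C>"
  proof -
    have "K \<subseteq> \<Union>(components V)" using V(3) by simp
    then obtain F where F: "F \<subseteq> components V" "finite F" "K \<subseteq> \<Union>F"
      using compactE[OF K(1), of "components V"] opn by metis
    have "\<C> \<subseteq> F"
    proof
      fix C assume C: "C \<in> \<C>"
      then obtain x where x: "x \<in> C" "x \<in> K" "C \<in> components V" by (auto simp: \<C>_def)
      then obtain D where "D \<in> F" "x \<in> D" using F(3) by auto
      then show "C \<in> F" using disj[of C D] x F(1) by blast
    qed
    then show ?thesis using F(2) finite_subset by blast
  qed
  have sub: "\<C> \<subseteq> components V" by (auto simp: \<C>_def)
  have K_sub: "K \<subseteq> \<Union>\<C>"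
  proof
    fix x assume x: "x \<in> K"
    then obtain C where "C \<in> components V" "x \<in> C" using V(3) cover by blast
    with x show "x \<in> \<Union>\<C>" by (auto simp: \<C>_def)
  qed
  have interval: "\<exists>a b. C = {a<..<b}" if "C \<in> \<C>" for C
  proof -
    have C: "C \<in> components V" using that sub by auto
    then show ?thesis
      using open_connected_bounded_real_eq_interval[OF opn[OF C] in_components_connected[OF C]
         bounded_subset[OF V(2) in_components_subset[OF C]] in_components_nonempty[OF C]] by metis
  qed
  have comp: "compact (K \<inter> C)" if "C \<in> \<C>" for C
  proof -
    have "C \<in> components V" using that sub by auto
    then have "K \<inter> C = K \<inter> - \<Union>(components V - {C})"
      using V(3) cover disj by blast
    moreover have "open (\<Union>(components V - {C}))" using opn by auto
    ultimately show ?thesis using compact_Int_closed[OF K(1) closed_Compl] by presburger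
  qed
  have CU: "C \<subseteq> U" if "C \<in> \<C>" for C
    using that sub in_components_subset V(4) by blast
  have split: "(LINT t|lborel. g t) = (\<Sum>C\<in>\<C>. LINT t:C|lborel. g t)"
    if "integrable lborel g" "\<And>t. t \<notin> K \<Longrightarrow> g t = 0" for g :: "real \<Rightarrow> real"
  proof -
    have "(LINT t|lborel. g t) = (LINT t:(\<Union>C\<in>\<C>. C)|lborel. g t)"
      unfolding set_lebesgue_integral_def
      by (rule Bochner_Integration.integral_cong) (use that K_sub in \<open>auto simp: indicator_def\<close>)
    also have "\<dots> = (\<Sum>C\<in>\<C>. LINT t:C|lborel. g t)"
    proof (rule set_integral_finite_Union[OF fin])
      show "disjoint_family_on (\<lambda>C. C) \<C>" using disj sub by (auto simp: disjoint_family_on_def)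
      fix C assume "C \<in> \<C>"
      then show C: "C \<in> sets lborel" using opn sub by auto
      show "set_integrable lborel C g"
        unfolding set_integrable_def by (rule integrable_mult_indicator[OF C that(1)])
    qed
    finally show ?thesis .
  qed
  have Eh: "(LINT t|lborel. h t) = (\<Sum>C\<in>\<C>. LINT t:C|lborel. h t)"
    by (rule split[OF int_h]) (use K(3) f'_eq_0 in auto)
  have "integrable lborel (\<lambda>t. f t ^ (2 * n))"
    by (rule integrable_lborel_continuous_compact_support[OF _ K(1)]) (use K(3) n in \<open>auto intro!: continuous_intros cont_on_f\<close>)
  then have A: "(LINT t|lborel. f t ^ (2 * n)) = (\<Sum>C\<in>\<C>. LINT t:C|lborel. f t ^ (2 * n))"
    by (rule split) (use K(3) n in auto)
  have E0: "0 \<le> (LINT t:C|lborel. h t)" if "C \<in> \<C>" for C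
    using interval[OF that] comp[OF that] CU[OF that] hardy_subinterval(1)[OF _ _ l n] by auto
  have A0: "0 \<le> (LINT t:C|lborel. f t ^ (2 * n))" for C
    unfolding set_lebesgue_integral_def by (rule integral_nonneg_AE) auto
  show E0': "0 \<le> (LINT t|lborel. h t)" unfolding Eh using E0 by (intro sum_nonneg)
  show "\<bar>f t\<bar> ^ Suc n \<le> (2 * n + 3) * (l * (LINT t|lborel. f t ^ (2 * n)) + (LINT t|lborel. h t) / l)"
  proof (cases "t \<in> K")
    case True
    then obtain C where C: "C \<in> \<C>" "t \<in> C" using K_sub by auto
    have "\<bar>f t\<bar> ^ Suc n \<le> (2 * n + 3) * (l * (LINT t:C|lborel. f t ^ (2 * n)) + (LINT t:C|lborel. h t) / l)"
      using interval[OF C(1)] comp[OF C(1)] CU[OF C(1)] C(2) hardy_subinterval(2)[OF _ _ l n] by auto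
    also have "\<dots> \<le> (2 * n + 3) * (l * (LINT t|lborel. f t ^ (2 * n)) + (LINT t|lborel. h t) / l)"
      unfolding Eh A using l A0 E0 C(1) fin
      by (intro mult_left_mono add_mono divide_right_mono member_le_sum) auto
    finally show ?thesis .
  next
    case False
    have "0 \<le> (LINT t|lborel. f t ^ (2 * n))" by (rule integral_nonneg_AE) auto
    then show ?thesis using False K(3) E0' l by auto
  qed
qed

end

section \<open>Orthonormal frames in the plane\<close>

text \<open>If \<open>c \<noteq> 0\<close>, the rotation is an affine substitution in the first variable followed by one in the
second, with Jacobians \<open>c\<close> and \<open>1 / c\<close>. If \<open>c = 0\<close>, it exchanges the variables up to signs.\<close>

lemma nn_integral_lborel_rotate:
  fixes g :: "real \<times> real \<Rightarrow> ennreal" and c k :: real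
  assumes g[measurable]: "g \<in> borel_measurable borel" and ck: "c\<^sup>2 + k\<^sup>2 = 1"
  shows "(\<integral>\<^sup>+p. g (c * fst p - k * snd p, k * fst p + c * snd p) \<partial>lborel) = (\<integral>\<^sup>+p. g p \<partial>lborel)"
proof -
  have [measurable]: "g \<in> borel_measurable (borel \<Otimes>\<^sub>M borel)" by (simp add: borel_prod)
  have iter1: "(\<integral>\<^sup>+p. G p \<partial>lborel) = (\<integral>\<^sup>+r. \<integral>\<^sup>+s. G (s, r) \<partial>lborel \<partial>lborel)"
    and iter2: "(\<integral>\<^sup>+p. G p \<partial>lborel) = (\<integral>\<^sup>+s. \<integral>\<^sup>+r. G (s, r) \<partial>lborel \<partial>lborel)"
    if "G \<in> borel_measurable borel" for G :: "real \<times> real \<Rightarrow> ennreal"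
  proof -
    have [measurable]: "G \<in> borel_measurable (lborel \<Otimes>\<^sub>M lborel)"
      using that unfolding lborel_prod by simp
    show "(\<integral>\<^sup>+p. G p \<partial>lborel) = (\<integral>\<^sup>+r. \<integral>\<^sup>+s. G (s, r) \<partial>lborel \<partial>lborel)"
      unfolding lborel_prod[symmetric] by (subst lborel_pair.nn_integral_snd) auto
    show "(\<integral>\<^sup>+p. G p \<partial>lborel) = (\<integral>\<^sup>+s. \<integral>\<^sup>+r. G (s, r) \<partial>lborel \<partial>lborel)"
      unfolding lborel_prod[symmetric] by (subst lborel.nn_integral_fst) auto
  qed
  have L: "(\<integral>\<^sup>+p. g (c * fst p - k * snd p, k * fst p + c * snd p) \<partial>lborel)
      = (\<integral>\<^sup>+r. \<integral>\<^sup>+s. g (c * s - k * r, k * s + c * r) \<partial>lborel \<partial>lborel)" (is "?L = _")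
  proof (subst iter1)
    have "(\<lambda>p. (c * fst p - k * snd p, k * fst p + c * snd p)) \<in> borel_measurable borel"
      by (intro borel_measurable_continuous_onI continuous_intros)
    then show "(\<lambda>p. g (c * fst p - k * snd p, k * fst p + c * snd p)) \<in> borel_measurable borel"
      by measurable
  qed simp
  show ?thesis
  proof (cases "c = 0")
    case False
    have inner: "\<bar>c\<bar> * (\<integral>\<^sup>+s. g (c * s - k * r, k * s + c * r) \<partial>lborel)
        = (\<integral>\<^sup>+x. g (x, (k * x + r) / c) \<partial>lborel)" for r
    proof -
      have "(k * (- k * r + c * s) + r) / c = k * s + c * r" for s
      proof -
        have "k * (- k * r + c * s) + r = r * (1 - k\<^sup>2) + k * c * s"
          by (simp add: power2_eq_square algebra_simps)
        also have "1 - k\<^sup>2 = c\<^sup>2" using ck by simp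
        finally show ?thesis using False by (simp add: power2_eq_square field_simps)
      qed
      then show ?thesis
        by (subst nn_integral_real_affine[OF _ False, where t = "- k * r"]) (simp_all add: algebra_simps)
    qed
    have outer: "\<bar>c\<bar> * (\<integral>\<^sup>+y. g (x, y) \<partial>lborel) = (\<integral>\<^sup>+r. g (x, (k * x + r) / c) \<partial>lborel)" for x
      using False
      by (subst nn_integral_real_affine[where t = "k * x / c" and c = "1 / c"])
        (auto simp: add_divide_distrib mult.assoc[symmetric] ennreal_mult[symmetric])
    have "\<bar>c\<bar> * ?L = (\<integral>\<^sup>+r. \<integral>\<^sup>+x. g (x, (k * x + r) / c) \<partial>lborel \<partial>lborel)"
      unfolding L by (subst nn_integral_cmult[symmetric]) (auto simp: inner)
    also have "\<dots> = (\<integral>\<^sup>+x. \<integral>\<^sup>+r. g (x, (k * x + r) / c) \<partial>lborel \<partial>lborel)"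
      by (rule lborel_pair.Fubini') measurable
    also have "\<dots> = \<bar>c\<bar> * (\<integral>\<^sup>+p. g p \<partial>lborel)"
      unfolding outer[symmetric] by (subst nn_integral_cmult) (auto simp: iter2)
    finally show ?thesis
      using False by (simp add: ennreal_mult_cancel_left)
  next
    case True
    then have k: "\<bar>k\<bar> = 1" "k \<noteq> 0" using ck by (auto simp: power2_eq_1_iff)
    have "?L = (\<integral>\<^sup>+r. \<integral>\<^sup>+s. g (- k * r, k * s) \<partial>lborel \<partial>lborel)"
      unfolding L by (simp add: True)
    also have "\<dots> = (\<integral>\<^sup>+r. \<integral>\<^sup>+s. g (- k * r, s) \<partial>lborel \<partial>lborel)"
    proof -
      have "(\<integral>\<^sup>+s. g (x, k * s) \<partial>lborel) = (\<integral>\<^sup>+s. g (x, s) \<partial>lborel)" for x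
        using nn_integral_real_affine[OF _ k(2), where t = 0 and f = "\<lambda>s. g (x, s)"] k by simp
      then show ?thesis by simp
    qed
    also have "\<dots> = (\<integral>\<^sup>+r. \<integral>\<^sup>+s. g (r, s) \<partial>lborel \<partial>lborel)"
      using nn_integral_real_affine[where t = 0 and c = "- k" and f = "\<lambda>r. \<integral>\<^sup>+s. g (r, s) \<partial>lborel"] k
      by simp
    finally show ?thesis by (simp add: iter2)
  qed
qed

context
  fixes b1 b2 :: "'a::euclidean_space"
  assumes basis: "Basis = {b1, b2}" "b1 \<noteq> b2"
begin

text \<open>A right-angle rotation given by a formula completes every unit vector \<open>e\<close> to an orthonormal frame in a
way that is linear in \<open>e\<close> and preserves Lebesgue measure.\<close>

definition quarter_turn :: "'a \<Rightarrow> 'a" where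
  "quarter_turn v = (v \<bullet> b1) *\<^sub>R b2 - (v \<bullet> b2) *\<^sub>R b1"

lemma basis_inner: "b1 \<bullet> b1 = 1" "b2 \<bullet> b2 = 1" "b1 \<bullet> b2 = 0" "b2 \<bullet> b1 = 0"
  using inner_Basis[of b1 b1] inner_Basis[of b2 b2] inner_Basis[of b1 b2] inner_Basis[of b2 b1]
  by (simp_all add: basis basis(2)[symmetric])

lemma basis_rep: "(v \<bullet> b1) *\<^sub>R b1 + (v \<bullet> b2) *\<^sub>R b2 = v"
proof -
  have "(\<Sum>b\<in>{b1, b2}. (v \<bullet> b) *\<^sub>R b) = v"
    using euclidean_representation[of v] by (simp only: basis(1))
  then show ?thesis using basis(2) by simp
qed

private lemma frame_measurable [measurable]:
  "(\<lambda>p. fst p *\<^sub>R v + snd p *\<^sub>R w :: 'a) \<in> borel_measurable borel"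
  by (intro borel_measurable_continuous_onI continuous_intros)

lemma norm_quarter_turn: "norm (quarter_turn v) = norm v"
proof -
  have "quarter_turn v \<bullet> quarter_turn v = (v \<bullet> b1)\<^sup>2 + (v \<bullet> b2)\<^sup>2"
    by (simp add: quarter_turn_def inner_diff_left inner_diff_right basis_inner power2_eq_square)
  also have "\<dots> = v \<bullet> v"
    using euclidean_inner[of v v] basis(2) unfolding basis(1) by (simp add: power2_eq_square)
  finally show ?thesis by (simp add: norm_eq_sqrt_inner)
qed

lemma sum_squares_orthonormal_frame:
  fixes D :: "'a \<Rightarrow> real"
  assumes "linear D" "norm e = 1"
  shows "(D e)\<^sup>2 + (D (quarter_turn e))\<^sup>2 = (\<Sum>b\<in>Basis. (D b)\<^sup>2)"
proof -
  have "1 = e \<bullet> e" using assms(2) by (simp add: dot_square_norm)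
  also have "\<dots> = (e \<bullet> b1)\<^sup>2 + (e \<bullet> b2)\<^sup>2"
    using euclidean_inner[of e e] basis(2) unfolding basis(1) by (simp add: power2_eq_square)
  finally have *: "(e \<bullet> b1)\<^sup>2 + (e \<bullet> b2)\<^sup>2 = 1" by simp
  have "D e = (e \<bullet> b1) * D b1 + (e \<bullet> b2) * D b2"
    using assms(1) by (subst basis_rep[of e, symmetric]) (simp add: linear_add linear_scale)
  moreover have "D (quarter_turn e) = (e \<bullet> b1) * D b2 - (e \<bullet> b2) * D b1"
    using assms(1) by (simp add: quarter_turn_def linear_diff linear_scale)
  ultimately have "(D e)\<^sup>2 + (D (quarter_turn e))\<^sup>2
      = ((e \<bullet> b1)\<^sup>2 + (e \<bullet> b2)\<^sup>2) * ((D b1)\<^sup>2 + (D b2)\<^sup>2)"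
    by (simp only:) (simp add: power2_eq_square algebra_simps)
  then show ?thesis using basis(2) unfolding basis(1) by (simp add: *)
qed

lemma distr_lborel_basis_coords:
  "distr lborel borel (\<lambda>p. fst p *\<^sub>R b1 + snd p *\<^sub>R b2) = lborel"
proof (rule lborel_eqI[symmetric])
  fix l u :: 'a assume lu: "\<And>b. b \<in> Basis \<Longrightarrow> l \<bullet> b \<le> u \<bullet> b"
  have "emeasure (distr lborel borel (\<lambda>p. fst p *\<^sub>R b1 + snd p *\<^sub>R b2)) (box l u)
    = emeasure lborel ((\<lambda>p::real \<times> real. fst p *\<^sub>R b1 + snd p *\<^sub>R b2) -` box l u)"
    by (subst emeasure_distr) auto
  also have "(\<lambda>p. fst p *\<^sub>R b1 + snd p *\<^sub>R b2) -` box l u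
      = {l \<bullet> b1<..<u \<bullet> b1} \<times> {l \<bullet> b2<..<u \<bullet> b2}"
    by (auto simp: box_def basis inner_add_left basis_inner)
  also have "emeasure lborel \<dots> = ennreal (u \<bullet> b1 - l \<bullet> b1) * ennreal (u \<bullet> b2 - l \<bullet> b2)"
    using lu by (subst lborel_prod[symmetric], subst lborel.emeasure_pair_measure_Times) (auto simp: basis)
  also have "\<dots> = (\<Prod>b\<in>Basis. (u - l) \<bullet> b)"
    using lu basis(2) by (simp add: basis ennreal_mult inner_diff_left)
  finally show "emeasure (distr lborel borel (\<lambda>p. fst p *\<^sub>R b1 + snd p *\<^sub>R b2)) (box l u)
    = (\<Prod>b\<in>Basis. (u - l) \<bullet> b)" .
qed simp

lemma nn_integral_orthonormal_frame:
  fixes e :: 'a and g :: "'a \<Rightarrow> ennreal"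
  assumes e: "norm e = 1" and g[measurable]: "g \<in> borel_measurable borel"
  shows "(\<integral>\<^sup>+p. g (fst p *\<^sub>R e + snd p *\<^sub>R quarter_turn e) \<partial>lborel) = (\<integral>\<^sup>+x. g x \<partial>lborel)"
proof -
  define c where "c = e \<bullet> b1"
  define k where "k = e \<bullet> b2"
  have e_eq: "e = c *\<^sub>R b1 + k *\<^sub>R b2" using basis_rep[of e] by (simp add: c_def k_def)
  have "1 = e \<bullet> e" using e by (simp add: dot_square_norm)
  also have "\<dots> = c\<^sup>2 + k\<^sup>2"
    by (subst e_eq, subst e_eq) (simp add: inner_add_left inner_add_right basis_inner power2_eq_square)
  finally have ck: "c\<^sup>2 + k\<^sup>2 = 1" by simp
  have "(\<integral>\<^sup>+x. g x \<partial>lborel) = (\<integral>\<^sup>+p. g (fst p *\<^sub>R b1 + snd p *\<^sub>R b2) \<partial>lborel)"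
    by (subst distr_lborel_basis_coords[symmetric], subst nn_integral_distr) auto
  also have "\<dots> = (\<integral>\<^sup>+p. g ((c * fst p - k * snd p) *\<^sub>R b1 + (k * fst p + c * snd p) *\<^sub>R b2) \<partial>lborel)"
    by (subst nn_integral_lborel_rotate[OF _ ck, symmetric]) auto
  also have "(\<lambda>p. (c * fst p - k * snd p) *\<^sub>R b1 + (k * fst p + c * snd p) *\<^sub>R b2)
      = (\<lambda>p. fst p *\<^sub>R e + snd p *\<^sub>R quarter_turn e)"
    unfolding quarter_turn_def c_def[symmetric] k_def[symmetric]
    by (subst e_eq) (simp add: fun_eq_iff algebra_simps)
  finally show ?thesis by simp
qed

lemma distr_lborel_orthonormal_frame:
  assumes e: "norm e = 1"
  shows "distr lborel borel (\<lambda>p. fst p *\<^sub>R e + snd p *\<^sub>R quarter_turn e) = lborel"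
proof (rule measure_eqI)
  fix A assume "A \<in> sets (distr lborel borel (\<lambda>p. fst p *\<^sub>R e + snd p *\<^sub>R quarter_turn e))"
  then have A[measurable]: "A \<in> sets borel" by simp
  have "emeasure (distr lborel borel (\<lambda>p. fst p *\<^sub>R e + snd p *\<^sub>R quarter_turn e)) A
    = (\<integral>\<^sup>+x. indicator A x \<partial>distr lborel borel (\<lambda>p. fst p *\<^sub>R e + snd p *\<^sub>R quarter_turn e))"
    by (subst nn_integral_indicator) auto
  also have "\<dots> = (\<integral>\<^sup>+x. indicator A x \<partial>lborel)"
    by (subst nn_integral_distr) (use nn_integral_orthonormal_frame[OF e, of "indicator A"] in auto)
  finally show "emeasure (distr lborel borel (\<lambda>p. fst p *\<^sub>R e + snd p *\<^sub>R quarter_turn e)) A = emeasure lborel A"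
    by simp
qed simp

lemma nn_integral_quarter_turn:
  fixes g :: "'a \<Rightarrow> ennreal"
  assumes g[measurable]: "g \<in> borel_measurable borel"
  shows "(\<integral>\<^sup>+x. g (quarter_turn x) \<partial>lborel) = (\<integral>\<^sup>+x. g x \<partial>lborel)"
proof -
  have [measurable]: "quarter_turn \<in> borel_measurable borel" unfolding quarter_turn_def by measurable
  have turn: "quarter_turn (x *\<^sub>R b1 + y *\<^sub>R b2) = x *\<^sub>R b2 + y *\<^sub>R quarter_turn b2" for x y
    by (simp add: quarter_turn_def inner_add_left basis_inner)
  have "(\<integral>\<^sup>+x. g (quarter_turn x) \<partial>lborel)
      = (\<integral>\<^sup>+p. g (quarter_turn (fst p *\<^sub>R b1 + snd p *\<^sub>R b2)) \<partial>lborel)"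
    by (subst distr_lborel_basis_coords[symmetric], subst nn_integral_distr) auto
  also have "\<dots> = (\<integral>\<^sup>+x. g x \<partial>lborel)"
    unfolding turn by (rule nn_integral_orthonormal_frame) (auto simp: basis)
  finally show ?thesis .
qed

end

text \<open>The pairs \<open>(e, x)\<close> for which some \<open>x + t e\<close> with \<open>|t| \<le> r\<close> lies outside \<open>\<Omega>\<close> form a closed set, the projection
of a closed set along a compact interval. A strict sublevel set of the distance is the union of these
closed sets over countably many rational \<open>r\<close>.\<close>

lemma dir_dist_measurable_pair:
  fixes \<Omega> :: "'a::euclidean_space set"
  assumes "open \<Omega>"
  shows "(\<lambda>p. dir_dist \<Omega> (fst p) (snd p)) \<in> borel_measurable borel"
proof (rule borel_measurableI_less)
  fix y :: ennreal
  have "{p \<in> space borel. dir_dist \<Omega> (fst p) (snd p) < y}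
      = (\<Union>r\<in>{r\<in>\<rat>. ennreal r < y}. {p. \<exists>t. t \<in> {-r..r} \<and> (t, p) \<in> {q. snd (snd q) + fst q *\<^sub>R fst (snd q) \<in> - \<Omega>}})"
    (is "?L = ?R")
  proof (intro equalityI subsetI)
    fix p assume "p \<in> ?L"
    then obtain t where t: "snd p + t *\<^sub>R fst p \<in> - \<Omega>" "ennreal \<bar>t\<bar> < y"
      by (auto simp: dir_dist_def INF_less_iff)
    obtain r where "r \<in> \<rat>" "\<bar>t\<bar> \<le> r" "ennreal r < y"
    proof (cases y)
      case (real y')
      then have "\<bar>t\<bar> < y'" using t(2) by (simp add: ennreal_less_iff)
      then obtain r where "r \<in> \<rat>" "\<bar>t\<bar> < r" "r < y'" using Rats_dense_in_real by blast
      then show ?thesis using that[of r] real by (auto simp: ennreal_less_iff)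
    next
      case top
      obtain r where "r \<in> \<rat>" "\<bar>t\<bar> < r" using Rats_dense_in_real[of "\<bar>t\<bar>" "\<bar>t\<bar> + 1"] by auto
      then show ?thesis using that[of r] top by auto
    qed
    then show "p \<in> ?R" using t by (intro UN_I[of r]) (auto intro!: exI[of _ t])
  next
    fix p assume "p \<in> ?R"
    then obtain r t where "ennreal r < y" "\<bar>t\<bar> \<le> r" "snd p + t *\<^sub>R fst p \<in> - \<Omega>"
      by (auto simp: abs_le_iff minus_le_iff)
    moreover from this have "ennreal \<bar>t\<bar> < y" by (meson ennreal_leI le_less_trans)
    ultimately show "p \<in> ?L" by (auto simp: dir_dist_def INF_less_iff)
  qed
  also have "\<dots> \<in> sets borel"
  proof (rule sets.countable_UN'')
    show "countable {r \<in> \<rat>. ennreal r < y}" by (rule countable_subset[OF _ countable_rat]) auto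
    have "closed ((\<lambda>q::real \<times> 'a \<times> 'a. snd (snd q) + fst q *\<^sub>R fst (snd q)) -` (- \<Omega>))"
      using assms by (intro closed_vimage continuous_intros) auto
    then have "closed {p. \<exists>t. t \<in> {-r..r} \<and> (t, p) \<in> {q. snd (snd q) + fst q *\<^sub>R fst (snd q) \<in> - \<Omega>}}" for r
      by (intro closed_compact_projection) (auto simp: vimage_def)
    then show "{p. \<exists>t. t \<in> {-r..r} \<and> (t, p) \<in> {q. snd (snd q) + fst q *\<^sub>R fst (snd q) \<in> - \<Omega>}} \<in> sets borel" for r
      by (rule borel_closed)
  qed
  finally show "{p \<in> space borel. dir_dist \<Omega> (fst p) (snd p) < y} \<in> sets borel" .
qed

section \<open>Directional weights and their spherical mean\<close>

definition dir_weight :: "'a::euclidean_space set \<Rightarrow> 'a \<Rightarrow> 'a \<Rightarrow> ennreal" where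
  "dir_weight \<Omega> e x = inverse ((dir_dist \<Omega> e x)\<^sup>2)"

lemma dir_weight_le:
  assumes "0 < \<rho>" "\<And>t. \<bar>t\<bar> < \<rho> \<Longrightarrow> x + t *\<^sub>R e \<in> \<Omega>"
  shows "dir_weight \<Omega> e x \<le> ennreal (1 / \<rho>\<^sup>2)"
proof -
  have "ennreal \<rho> \<le> dir_dist \<Omega> e x"
    unfolding dir_dist_def using assms(2) by (intro INF_greatest ennreal_leI) force
  then have "inverse ((dir_dist \<Omega> e x)\<^sup>2) \<le> ennreal (1 / \<rho>\<^sup>2)"
  proof (cases "dir_dist \<Omega> e x")
    case (real y)
    then have "\<rho> \<le> y" using \<open>ennreal \<rho> \<le> dir_dist \<Omega> e x\<close> by simp
    then have "inverse (y\<^sup>2) \<le> 1 / \<rho>\<^sup>2" "0 < y"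
      using assms(1) by (auto simp: inverse_eq_divide intro!: divide_left_mono power_mono)
    then show ?thesis using real by (simp add: ennreal_power inverse_ennreal ennreal_leI)
  qed simp
  then show ?thesis by (simp add: dir_weight_def)
qed

lemma dir_weight_measurable_pair:
  assumes "open \<Omega>"
  shows "(\<lambda>p. dir_weight \<Omega> (fst p) (snd p)) \<in> borel_measurable borel"
  unfolding dir_weight_def
  by (rule borel_measurable_inverse_ennreal[OF borel_measurable_power_ennreal[OF dir_dist_measurable_pair[OF assms]]])

lemma dir_weight_measurable:
  assumes "open \<Omega>"
  shows "dir_weight \<Omega> e \<in> borel_measurable borel"
proof -
  have "(\<lambda>x. (e, x)) \<in> borel_measurable borel"
    by (intro borel_measurable_continuous_onI continuous_intros)
  from measurable_compose[OF this dir_weight_measurable_pair[OF assms]] show ?thesis by simp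
qed

text \<open>This is \<open>1 / D\<^sup>2\<close> for the weight \<open>D\<close> of the theorem. Unlike \<open>D\<close>, it is an integral, to which Fubini's theorem applies.\<close>

definition mean_dir_weight :: "'a::euclidean_space set \<Rightarrow> 'a \<Rightarrow> ennreal" where
  "mean_dir_weight \<Omega> x = of_nat DIM('a) / emeasure sphere_measure (sphere (0::'a) 1) *
     (\<integral>\<^sup>+ e. dir_weight \<Omega> e x \<partial>sphere_measure)"

text \<open>In polar coordinates the mean over the sphere is the mean over the unit ball of this function of \<open>z\<close>.\<close>

definition radial_dir_weight :: "'a::euclidean_space set \<Rightarrow> 'a \<Rightarrow> 'a \<Rightarrow> ennreal" where
  "radial_dir_weight \<Omega> z x = dir_weight \<Omega> (z /\<^sub>R norm z) x * indicator (ball 0 1 - {0}) z"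

lemma radial_dir_weight_measurable_pair:
  fixes \<Omega> :: "'a::euclidean_space set"
  assumes "open \<Omega>"
  shows "(\<lambda>(z, x). radial_dir_weight \<Omega> z x) \<in> borel_measurable (borel \<Otimes>\<^sub>M borel)"
proof -
  have 1: "(\<lambda>p::'a \<times> 'a. (fst p /\<^sub>R norm (fst p), snd p)) \<in> measurable (borel \<Otimes>\<^sub>M borel) (borel \<Otimes>\<^sub>M borel)"
    by measurable
  have 2: "(\<lambda>p. dir_weight \<Omega> (fst p) (snd p)) \<in> borel_measurable (borel \<Otimes>\<^sub>M borel)"
    using dir_weight_measurable_pair[OF assms] by (simp add: borel_prod)
  have [measurable]:
    "(\<lambda>p. dir_weight \<Omega> (fst p /\<^sub>R norm (fst p)) (snd p)) \<in> borel_measurable (borel \<Otimes>\<^sub>M borel)"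
    using measurable_compose[OF 1 2] by simp
  have [measurable]: "ball 0 1 - {0::'a} \<in> sets borel" by simp
  show ?thesis
    unfolding radial_dir_weight_def case_prod_unfold by measurable
qed

lemma radial_dir_weight_measurable:
  assumes "open \<Omega>"
  shows "(\<lambda>z. radial_dir_weight \<Omega> z x) \<in> borel_measurable borel"
  using measurable_compose[OF measurable_Pair2'[of x borel borel] radial_dir_weight_measurable_pair[OF assms]]
  by (simp cong: measurable_cong_sets)

lemma emeasure_unit_ball_pos_finite:
  "emeasure lborel (ball (0::'a::euclidean_space) 1) \<noteq> 0"
  "emeasure lborel (ball (0::'a::euclidean_space) 1) \<noteq> top"
proof -
  have "emeasure lborel (ball (0::'a) 1) = ennreal (unit_ball_vol (real DIM('a)))"
    by (simp add: emeasure_ball)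
  moreover have "unit_ball_vol (real DIM('a)) > 0" by (rule unit_ball_vol_pos) simp
  ultimately show "emeasure lborel (ball (0::'a) 1) \<noteq> 0" "emeasure lborel (ball (0::'a) 1) \<noteq> top"
    by (simp_all add: ennreal_eq_0_iff not_le)
qed

lemma mean_dir_weight_eq:
  fixes \<Omega> :: "'a::euclidean_space set"
  assumes "open \<Omega>"
  shows "emeasure lborel (ball (0::'a) 1) * mean_dir_weight \<Omega> x =
    of_nat DIM('a) * (\<integral>\<^sup>+ z. radial_dir_weight \<Omega> z x \<partial>lborel)"
proof -
  let ?N = "of_nat DIM('a) :: ennreal"
  have "(\<lambda>e. (e, x)) \<in> borel_measurable borel"
    by (intro borel_measurable_continuous_onI continuous_intros)
  from measurable_compose[OF this dir_weight_measurable_pair[OF assms]]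
  have [measurable]: "(\<lambda>e. dir_weight \<Omega> e x) \<in> borel_measurable borel" by simp
  have "(\<integral>\<^sup>+ e. dir_weight \<Omega> e x \<partial>sphere_measure)
      = ?N * (\<integral>\<^sup>+ z. dir_weight \<Omega> (z /\<^sub>R norm z) x \<partial>restrict_space lborel (ball 0 1 - {0}))"
    unfolding sphere_measure_def
    by (subst nn_integral_scale_measure, simp add: measurable_restrict_space1)
       (subst nn_integral_distr[OF measurable_sphere_proj], auto intro: measurable_restrict_space1)
  also have "(\<integral>\<^sup>+ z. dir_weight \<Omega> (z /\<^sub>R norm z) x \<partial>restrict_space lborel (ball 0 1 - {0}))
      = (\<integral>\<^sup>+ z. radial_dir_weight \<Omega> z x \<partial>lborel)"
    unfolding radial_dir_weight_def by (subst nn_integral_restrict_space) auto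
  finally have 1: "(\<integral>\<^sup>+ e. dir_weight \<Omega> e x \<partial>sphere_measure) = ?N * (\<integral>\<^sup>+ z. radial_dir_weight \<Omega> z x \<partial>lborel)" .
  have N: "?N = ennreal (real DIM('a))" by (simp add: ennreal_of_nat_eq_real_of_nat)
  have "emeasure lborel (ball (0::'a) 1) * (?N / emeasure sphere_measure (sphere (0::'a) 1)) = 1"
    using unit_ball_vol_pos[of "real DIM('a)"] unfolding emeasure_sphere_measure_total N
    by (simp add: emeasure_ball ennreal_mult[symmetric] divide_ennreal del: unit_ball_vol_pos)
  then show ?thesis
    unfolding mean_dir_weight_def 1 by (simp add: mult.assoc[symmetric])
qed

lemma mean_dir_weight_measurable:
  fixes \<Omega> :: "'a::euclidean_space set"
  assumes \<Omega>: "open \<Omega>"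
  shows "mean_dir_weight \<Omega> \<in> borel_measurable borel"
proof -
  have [measurable]: "(\<lambda>(x, z). radial_dir_weight \<Omega> z x) \<in> borel_measurable (borel \<Otimes>\<^sub>M lborel)"
    using measurable_compose[OF measurable_pair_swap' radial_dir_weight_measurable_pair[OF \<Omega>]]
    by (simp add: case_prod_unfold cong: measurable_cong_sets)
  have [measurable]: "(\<lambda>x. \<integral>\<^sup>+ z. radial_dir_weight \<Omega> z x \<partial>lborel) \<in> borel_measurable borel"
    by (rule lborel.borel_measurable_nn_integral) measurable
  have "mean_dir_weight \<Omega> x = of_nat DIM('a) * (\<integral>\<^sup>+ z. radial_dir_weight \<Omega> z x \<partial>lborel)
      / emeasure lborel (ball (0::'a) 1)" for x
    unfolding mean_dir_weight_eq[OF \<Omega>, symmetric]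
    using emeasure_unit_ball_pos_finite[where 'a = 'a]
    by (simp add: ennreal_mult_divide_eq mult.commute[of "emeasure _ _"])
  then have "mean_dir_weight \<Omega> = (\<lambda>x. of_nat DIM('a) * (\<integral>\<^sup>+ z. radial_dir_weight \<Omega> z x \<partial>lborel)
      / emeasure lborel (ball (0::'a) 1))" by blast
  then show ?thesis by simp
qed

lemma nn_integral_mean_dir_weight:
  fixes \<Omega> :: "'a::euclidean_space set" and F :: "'a \<Rightarrow> ennreal"
  assumes \<Omega>: "open \<Omega>" and F[measurable]: "F \<in> borel_measurable borel"
  shows "emeasure lborel (ball (0::'a) 1) * (\<integral>\<^sup>+x. F x * mean_dir_weight \<Omega> x \<partial>lborel) =
    of_nat DIM('a) * (\<integral>\<^sup>+z. \<integral>\<^sup>+x. F x * radial_dir_weight \<Omega> z x \<partial>lborel \<partial>lborel)"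
proof -
  let ?V = "emeasure lborel (ball (0::'a) 1)"
  note R = radial_dir_weight_measurable_pair[OF \<Omega>]
  have [measurable]: "(\<lambda>(x, z). radial_dir_weight \<Omega> z x) \<in> borel_measurable (borel \<Otimes>\<^sub>M lborel)"
    using measurable_compose[OF measurable_pair_swap' R] by (simp add: case_prod_unfold cong: measurable_cong_sets)
  have [measurable]: "(\<lambda>x. \<integral>\<^sup>+ z. radial_dir_weight \<Omega> z x \<partial>lborel) \<in> borel_measurable borel"
    by (rule lborel.borel_measurable_nn_integral) measurable
  note mean_dir_weight_measurable[OF \<Omega>, measurable]
  have "?V * (\<integral>\<^sup>+x. F x * mean_dir_weight \<Omega> x \<partial>lborel) = (\<integral>\<^sup>+x. F x * (?V * mean_dir_weight \<Omega> x) \<partial>lborel)"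
    by (subst nn_integral_cmult[symmetric]) (auto simp: mult_ac)
  also have "\<dots> = of_nat DIM('a) * (\<integral>\<^sup>+x. F x * (\<integral>\<^sup>+ z. radial_dir_weight \<Omega> z x \<partial>lborel) \<partial>lborel)"
    unfolding mean_dir_weight_eq[OF \<Omega>] by (subst nn_integral_cmult[symmetric]) (auto simp: mult_ac)
  also have "(\<integral>\<^sup>+x. F x * (\<integral>\<^sup>+ z. radial_dir_weight \<Omega> z x \<partial>lborel) \<partial>lborel)
      = (\<integral>\<^sup>+x. \<integral>\<^sup>+z. F x * radial_dir_weight \<Omega> z x \<partial>lborel \<partial>lborel)"
    using radial_dir_weight_measurable[OF \<Omega>] by (subst nn_integral_cmult) auto
  also have "\<dots> = (\<integral>\<^sup>+z. \<integral>\<^sup>+x. F x * radial_dir_weight \<Omega> z x \<partial>lborel \<partial>lborel)"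
    by (rule lborel_pair.Fubini') measurable
  finally show ?thesis .
qed

lemma average_le:
  fixes g :: "'a::euclidean_space \<Rightarrow> ennreal"
  assumes "emeasure lborel (ball (0::'a) 1) * I = (\<integral>\<^sup>+z. g z \<partial>lborel)"
    and "\<And>z. g z \<le> R * indicator (ball 0 1) z"
  shows "I \<le> R"
proof -
  have "emeasure lborel (ball (0::'a) 1) * I \<le> (\<integral>\<^sup>+z. R * indicator (ball (0::'a) 1) z \<partial>lborel)"
    unfolding assms(1) by (rule nn_integral_mono) (rule assms(2))
  also have "\<dots> = emeasure lborel (ball (0::'a) 1) * R"
    by (subst nn_integral_cmult_indicator) (auto simp: mult.commute)
  finally show ?thesis
    using emeasure_unit_ball_pos_finite[where 'a = 'a]
    by (simp add: ennreal_mult_le_mult_iff)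
qed

lemma mean_dir_weight_le:
  fixes \<Omega> :: "'a::euclidean_space set"
  assumes \<Omega>: "open \<Omega>" and "\<And>e. norm e = 1 \<Longrightarrow> dir_weight \<Omega> e x \<le> B"
  shows "mean_dir_weight \<Omega> x \<le> of_nat DIM('a) * B"
proof (rule average_le)
  show "emeasure lborel (ball (0::'a) 1) * mean_dir_weight \<Omega> x =
    (\<integral>\<^sup>+ z. of_nat DIM('a) * radial_dir_weight \<Omega> z x \<partial>lborel)"
    using radial_dir_weight_measurable[OF \<Omega>] unfolding mean_dir_weight_eq[OF \<Omega>]
    by (subst nn_integral_cmult) auto
  show "of_nat DIM('a) * radial_dir_weight \<Omega> z x \<le> of_nat DIM('a) * B * indicator (ball 0 1) z" for z
    using assms(2)[of "z /\<^sub>R norm z"]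
    by (auto simp: radial_dir_weight_def indicator_def intro!: mult_left_mono)
qed

text \<open>The quarter turn preserves Lebesgue measure on the unit ball, so the factor \<open>N = 2\<close> in front of the mean
of one directional weight can be spent on pairing each direction with the orthogonal one. A bound
valid in every frame therefore passes to the mean with the same constant.\<close>

lemma nn_integral_mean_dir_weight_le_planar:
  fixes \<Omega> :: "'a::euclidean_space set" and F :: "'a \<Rightarrow> ennreal" and b1 b2 :: 'a
  assumes basis: "Basis = {b1, b2}" "b1 \<noteq> b2" and \<Omega>: "open \<Omega>" and F[measurable]: "F \<in> borel_measurable borel"
    and le: "\<And>e. norm e = 1 \<Longrightarrow>
      (\<integral>\<^sup>+x. F x * (dir_weight \<Omega> e x + dir_weight \<Omega> (quarter_turn b1 b2 e) x) \<partial>lborel) \<le> R"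
  shows "(\<integral>\<^sup>+x. F x * mean_dir_weight \<Omega> x \<partial>lborel) \<le> R"
proof (rule average_le)
  let ?J = "quarter_turn b1 b2"
  let ?g = "\<lambda>z. \<integral>\<^sup>+x. F x * radial_dir_weight \<Omega> z x \<partial>lborel"
  have [measurable]: "(\<lambda>(z, x). radial_dir_weight \<Omega> z x) \<in> borel_measurable (borel \<Otimes>\<^sub>M lborel)"
    using radial_dir_weight_measurable_pair[OF \<Omega>] by (simp cong: measurable_cong_sets)
  have g[measurable]: "?g \<in> borel_measurable borel"
    by (rule lborel.borel_measurable_nn_integral) measurable
  have [measurable]: "?J \<in> borel_measurable borel"
    unfolding quarter_turn_def[OF basis] by measurable
  have [measurable]: "dir_weight \<Omega> e \<in> borel_measurable borel" for e
    by (rule dir_weight_measurable[OF \<Omega>])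
  have "card (Basis :: 'a set) = 2" using basis(2) unfolding basis(1) by simp
  then have "of_nat DIM('a) * (\<integral>\<^sup>+z. ?g z \<partial>lborel) = (\<integral>\<^sup>+z. ?g z \<partial>lborel) + (\<integral>\<^sup>+z. ?g (?J z) \<partial>lborel)"
    by (simp add: nn_integral_quarter_turn[OF basis g] mult_2)
  then show "emeasure lborel (ball (0::'a) 1) * (\<integral>\<^sup>+x. F x * mean_dir_weight \<Omega> x \<partial>lborel) =
     (\<integral>\<^sup>+z. ?g z + ?g (?J z) \<partial>lborel)"
    unfolding nn_integral_mean_dir_weight[OF \<Omega> F] by (subst nn_integral_add) auto
  fix z :: 'a
  let ?e = "z /\<^sub>R norm z"
  have J: "?J z = 0 \<longleftrightarrow> z = 0" "norm (?J z) = norm z" "?J z /\<^sub>R norm (?J z) = ?J ?e"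
    using norm_quarter_turn[OF basis, of z]
    by (auto simp: quarter_turn_def[OF basis] scaleR_diff_right)
  show "?g z + ?g (?J z) \<le> R * indicator (ball 0 1) z"
  proof (cases "z \<in> ball 0 1 - {0}")
    case True
    then have "?g z + ?g (?J z) = (\<integral>\<^sup>+x. F x * (dir_weight \<Omega> ?e x + dir_weight \<Omega> (?J ?e) x) \<partial>lborel)"
      using J by (subst nn_integral_add[symmetric]) (auto simp: radial_dir_weight_def distrib_left)
    also have "\<dots> \<le> R" using True by (intro le) auto
    finally show ?thesis using True by simp
  qed (auto simp: radial_dir_weight_def J indicator_def)
qed

lemma nn_integral_mean_dir_weight_le_one_dim:
  fixes \<Omega> :: "'a::euclidean_space set" and F :: "'a \<Rightarrow> ennreal"
  assumes basis: "DIM('a) = 1" and \<Omega>: "open \<Omega>" and F[measurable]: "F \<in> borel_measurable borel"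
    and le: "\<And>e. norm e = 1 \<Longrightarrow> (\<integral>\<^sup>+x. F x * dir_weight \<Omega> e x \<partial>lborel) \<le> R"
  shows "(\<integral>\<^sup>+x. F x * mean_dir_weight \<Omega> x \<partial>lborel) \<le> R"
proof (rule average_le)
  let ?g = "\<lambda>z. \<integral>\<^sup>+x. F x * radial_dir_weight \<Omega> z x \<partial>lborel"
  show "emeasure lborel (ball (0::'a) 1) * (\<integral>\<^sup>+x. F x * mean_dir_weight \<Omega> x \<partial>lborel) =
     (\<integral>\<^sup>+z. ?g z \<partial>lborel)"
    unfolding nn_integral_mean_dir_weight[OF \<Omega> F] by (simp add: basis)
  show "?g z \<le> R * indicator (ball 0 1) z" for z
  proof (cases "z \<in> ball 0 1 - {0}")
    case True
    then show ?thesis using le[of "z /\<^sub>R norm z"] by (simp add: radial_dir_weight_def)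
  qed (auto simp: radial_dir_weight_def indicator_def)
qed

lemma hardy_weight_term:
  assumes "mean_dir_weight \<Omega> x < top"
  shows "enn2real (ennreal (a\<^sup>2) / (4 * (hardy_weight \<Omega> x)\<^sup>2)) = a\<^sup>2 * enn2real (mean_dir_weight \<Omega> x) / 4"
proof -
  obtain w where w: "mean_dir_weight \<Omega> x = ennreal w" "w \<ge> 0"
    using assms by (cases "mean_dir_weight \<Omega> x") auto
  have hw: "hardy_weight \<Omega> x = inverse (ennreal (sqrt w))"
    using w by (simp add: hardy_weight_def inv_sqrt_ennreal_def mean_dir_weight_def dir_weight_def)
  show ?thesis
  proof (cases "w = 0")
    case False
    then have "4 * (hardy_weight \<Omega> x)\<^sup>2 = ennreal (4 / w)"
      unfolding hw using w(2)
      by (simp add: inverse_ennreal ennreal_power power_inverse ennreal_mult'' divide_inverse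
        flip: ennreal_numeral)
    then show ?thesis using False w by (simp add: divide_ennreal)
  \<comment> \<open>If the mean vanishes, the weight is infinite and both sides are zero.\<close>
  qed (simp add: hw w(1) ennreal_mult_top ennreal_top_mult power2_eq_square)
qed

section \<open>Real-valued functions with compact support\<close>

text \<open>A discriminant argument: the first claim is the limit of small \<open>l\<close>, the second one the choice
\<open>l = a / (2 A)\<close> that maximises the left-hand side of the hypothesis.\<close>

lemma nonneg_and_square_le_of_quadratic_family:
  fixes a A E :: real
  assumes A: "A \<ge> 0" and a: "a \<ge> 0" and le: "\<And>l. l > 0 \<Longrightarrow> l * (a - l * A) \<le> E"
  shows "E \<ge> 0" and "a\<^sup>2 \<le> 4 * A * E"
proof -
  show E: "E \<ge> 0"
  proof (rule ccontr)
    assume "\<not> E \<ge> 0"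
    then have E: "E < 0" by simp
    \<comment> \<open>Small enough that \<open>l\<^sup>2 A < - E\<close>.\<close>
    define l where "l = sqrt (- E / (A + 1))"
    have l: "l > 0" "l\<^sup>2 = - E / (A + 1)" using E A by (auto simp: l_def divide_neg_pos less_imp_le)
    have "- (l\<^sup>2 * A) \<le> l * (a - l * A)"
      using l(1) a by (simp add: power2_eq_square algebra_simps)
    also have "\<dots> \<le> E" by (rule le[OF l(1)])
    finally have "E * A \<le> E * (A + 1)" using A unfolding l(2) by (simp add: field_simps)
    then show False using E by (simp add: algebra_simps)
  qed
  show "a\<^sup>2 \<le> 4 * A * E"
  proof (cases "a = 0")
    case False
    then have a: "a > 0" using a by simp
    show ?thesis
    proof (cases "A = 0")
      case True
      \<comment> \<open>For \<open>A = 0\<close> the left-hand side is unbounded in \<open>l\<close>; this choice gives \<open>E + 1 \<le> E\<close>.\<close>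
      have "(E + 1) / a * (a - (E + 1) / a * A) \<le> E" using a E by (intro le) auto
      then show ?thesis using True a by simp
    next
      case False
      then have "A > 0" using A by simp
      then have "a / (2 * A) * (a - a / (2 * A) * A) \<le> E" using a by (intro le) auto
      then show ?thesis using \<open>A > 0\<close> by (simp add: field_simps power2_eq_square)
    qed
  qed (use A E in auto)
qed

text \<open>Interpolation between the exponents \<open>2\<close> and \<open>Q\<close> by a cut at height \<open>s\<close>; one of the two terms
dominates on each side of the cut. It is used with \<open>s\<^sup>2\<close> at least a fixed multiple of the energy.\<close>

lemma powr_interpolation:
  fixes x s p Q :: real
  assumes "x \<ge> 0" "s > 0" "2 \<le> p" "p \<le> Q"
  shows "x powr p \<le> s powr (p - Q) * x powr Q + s powr (p - 2) * x powr 2"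
proof (cases "x \<le> s")
  case True
  have "x powr p = x powr (p - 2) * x powr 2" by (simp add: powr_add[symmetric])
  also have "\<dots> \<le> s powr (p - 2) * x powr 2"
    using assms True by (intro mult_right_mono powr_mono2) auto
  finally show ?thesis using assms by (simp add: add_increasing)
next
  case False
  then have "x > 0" using assms by simp
  then have "x powr p = x powr (p - Q) * x powr Q" by (simp add: powr_add[symmetric])
  also have "\<dots> \<le> s powr (p - Q) * x powr Q"
    using assms False by (intro mult_right_mono powr_mono2') auto
  finally show ?thesis by (simp add: add_increasing2)
qed

text \<open>The real and the imaginary part of a test function on \<open>\<Omega>\<close> satisfy these hypotheses, with \<open>K\<close> the support of the test
function. The set \<open>K\<close> may be larger than the support of \<open>f\<close>, so that both parts can share it.\<close>

locale compactly_supported_C1 =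
  fixes f :: "'a::euclidean_space \<Rightarrow> real" and Df :: "'a \<Rightarrow> 'a \<Rightarrow> real" and K \<Omega> :: "'a set"
  assumes deriv: "\<And>x. (f has_derivative Df x) (at x)"
    and cont_D: "\<And>v. continuous_on UNIV (\<lambda>x. Df x v)"
    and K: "compact K" "K \<subseteq> \<Omega>" "\<And>x. x \<notin> K \<Longrightarrow> f x = 0"
    and \<Omega>: "open \<Omega>"
begin

lemma continuous_on_f: "continuous_on S f"
  using deriv by (meson has_derivative_continuous_on has_derivative_at_withinI)

lemma Df_eq_0: "Df x v = 0" if "x \<notin> K"
proof -
  have "open (- K)" using K(1) by (simp add: compact_imp_closed open_Compl)
  then have "((\<lambda>_. 0) has_derivative Df x) (at x)"
    using has_derivative_transform_within_open[OF deriv, of "- K" x "\<lambda>_. 0"] that K(3) by auto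
  then have "Df x = (\<lambda>_. 0)" using has_derivative_unique[OF _ has_derivative_const] by blast
  then show ?thesis by simp
qed

lemma dir_weight_bounded_on_support:
  obtains B where "B \<ge> 0" "\<And>x e. x \<in> K \<Longrightarrow> norm e = 1 \<Longrightarrow> dir_weight \<Omega> e x \<le> ennreal B"
proof -
  obtain d where d: "d > 0" "(\<Union>x\<in>K. ball x d) \<subseteq> \<Omega>"
    by (rule compact_subset_open_imp_ball_epsilon_subset[OF K(1) \<Omega> K(2)])
  have "dir_weight \<Omega> e x \<le> ennreal (1 / d\<^sup>2)" if "x \<in> K" "norm e = 1" for x e
  proof (rule dir_weight_le[OF d(1)])
    fix t :: real assume "\<bar>t\<bar> < d"
    then have "x + t *\<^sub>R e \<in> ball x d" using that(2) by (simp add: dist_norm)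
    then show "x + t *\<^sub>R e \<in> \<Omega>" using d(2) that(1) by blast
  qed
  then show ?thesis by (intro that[of "1 / d\<^sup>2"]) auto
qed

abbreviation (input) "dir_weight_real \<equiv> \<lambda>e x. enn2real (dir_weight \<Omega> e x)"

lemma dir_weight_real_measurable [measurable]: "dir_weight_real e \<in> borel_measurable borel"
  using dir_weight_measurable[OF \<Omega>] by measurable

lemma f_sq_weight_bound:
  obtains B where "\<And>x e. x \<in> K \<Longrightarrow> norm e = 1 \<Longrightarrow> \<bar>(f x)\<^sup>2 * dir_weight_real e x\<bar> \<le> B"
proof -
  obtain B where B: "B \<ge> 0" "\<And>x e. x \<in> K \<Longrightarrow> norm e = 1 \<Longrightarrow> dir_weight \<Omega> e x \<le> ennreal B"
    using dir_weight_bounded_on_support by blast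
  have "bounded (f ` K)" using continuous_on_f K(1) by (intro compact_imp_bounded compact_continuous_image)
  then obtain C where C: "\<And>x. x \<in> K \<Longrightarrow> \<bar>f x\<bar> \<le> C" by (auto simp: bounded_real)
  have "\<bar>(f x)\<^sup>2 * dir_weight_real e x\<bar> \<le> C\<^sup>2 * B" if x: "x \<in> K" "norm e = 1" for x e
  proof -
    have "(f x)\<^sup>2 \<le> C\<^sup>2" using C[OF x(1)] by (metis abs_le_square_iff abs_ge_self order_trans)
    moreover have "dir_weight_real e x \<le> B" using B(2)[OF x] B(1) enn2real_leI by blast
    ultimately show ?thesis by (simp add: abs_mult mult_mono)
  qed
  then show ?thesis by (rule that)
qed

lemma integrable_f_sq_dir_weight: "norm e = 1 \<Longrightarrow> integrable lborel (\<lambda>x. (f x)\<^sup>2 * dir_weight_real e x)"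
proof -
  assume e: "norm e = 1"
  obtain B where B: "\<And>x e. x \<in> K \<Longrightarrow> norm e = 1 \<Longrightarrow> \<bar>(f x)\<^sup>2 * dir_weight_real e x\<bar> \<le> B" by (rule f_sq_weight_bound) blast
  have [measurable]: "f \<in> borel_measurable borel" by (intro borel_measurable_continuous_onI continuous_on_f)
  show ?thesis
    by (rule integrable_lborel_bounded_compact_support[OF _ K(1), of _ B]) (use B e K(3) in auto)
qed

definition "dir_density e x = (Df x e)\<^sup>2 - (f x)\<^sup>2 * dir_weight_real e x / 4"

lemma integrable_deriv_sq: "integrable lborel (\<lambda>x. (Df x e)\<^sup>2)"
  by (rule integrable_lborel_continuous_compact_support[OF _ K(1)])
    (auto intro!: continuous_intros cont_D simp: Df_eq_0)

lemma integrable_dir_density: "norm e = 1 \<Longrightarrow> integrable lborel (dir_density e)"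
  unfolding dir_density_def using integrable_deriv_sq integrable_f_sq_dir_weight by (intro Bochner_Integration.integrable_diff) auto

lemma integrable_power: "n > 0 \<Longrightarrow> integrable lborel (\<lambda>x. f x ^ n)"
  by (rule integrable_lborel_continuous_compact_support[OF _ K(1)])
    (auto intro!: continuous_intros continuous_on_f simp: K(3))

text \<open>The restriction of \<open>f\<close> to a line is supported in the trace of \<open>\<Omega>\<close> on that line, whose distance function is
the directional distance, so that the result for open subsets of the line applies.\<close>

lemma hardy_on_line:
  fixes x e :: 'a and s l :: real and n :: nat
  assumes e: "norm e = 1" and l: "l > 0" and n: "n > 0"
  shows "0 \<le> (LINT s|lborel. dir_density e (x + s *\<^sub>R e))"
    and "\<bar>f (x + s *\<^sub>R e)\<bar> ^ Suc n \<le> (2 * n + 3) *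
      (l * (LINT s|lborel. f (x + s *\<^sub>R e) ^ (2 * n)) + (LINT s|lborel. dir_density e (x + s *\<^sub>R e)) / l)"
    and "integrable lborel (\<lambda>s. f (x + s *\<^sub>R e) ^ (2 * n))"
    and "integrable lborel (\<lambda>s. dir_density e (x + s *\<^sub>R e))"
proof -
  let ?line = "\<lambda>s. x + s *\<^sub>R e"
  have 1: "((\<lambda>s. f (?line s)) has_real_derivative Df (?line s) e) (at s)" for s
  proof -
    have "((\<lambda>s. f (?line s)) has_derivative (\<lambda>s'. Df (?line s) (s' *\<^sub>R e))) (at s)"
      by (rule has_derivative_compose[OF _ deriv]) (auto intro!: derivative_eq_intros)
    moreover have "linear (Df (?line s))" using deriv has_derivative_linear by blast
    ultimately show ?thesis
      by (simp add: has_field_derivative_def linear_scale[of "Df (?line s)"] mult.commute[of _ "Df _ _"])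
  qed
  have 2: "continuous_on UNIV (\<lambda>s. Df (?line s) e)"
    by (rule continuous_on_compose2[OF cont_D]) (auto intro!: continuous_intros)
  have 3: "compact (?line -` K)"
    unfolding compact_eq_bounded_closed
  proof
    show "closed (?line -` K)"
      using K(1) by (intro closed_vimage continuous_intros) (auto simp: compact_imp_closed)
    obtain B where B: "\<And>y. y \<in> K \<Longrightarrow> norm y \<le> B"
      using compact_imp_bounded[OF K(1)] by (auto simp: bounded_iff)
    have "\<bar>s\<bar> \<le> B + norm x" if "?line s \<in> K" for s
    proof -
      have "\<bar>s\<bar> = norm (?line s - x)" using e by simp
      also have "\<dots> \<le> B + norm x" using B[OF that] by (intro norm_triangle_le_diff) auto
      finally show ?thesis .
    qed
    then show "bounded (?line -` K)" by (auto simp: bounded_real)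
  qed
  have 4: "?line -` K \<subseteq> ?line -` \<Omega>" using K(2) by auto
  have 5: "open (?line -` \<Omega>)" using \<Omega> by (intro open_vimage continuous_intros)
  have 6: "dir_weight_real e (?line s) \<le> 1 / \<rho>\<^sup>2" if "0 < \<rho>" "{s - \<rho><..<s + \<rho>} \<subseteq> ?line -` \<Omega>" for s \<rho>
  proof -
    have "dir_weight \<Omega> e (?line s) \<le> ennreal (1 / \<rho>\<^sup>2)"
    proof (rule dir_weight_le[OF that(1)])
      fix t :: real assume "\<bar>t\<bar> < \<rho>"
      then have "s + t \<in> ?line -` \<Omega>" by (intro subsetD[OF that(2)]) auto
      then show "x + s *\<^sub>R e + t *\<^sub>R e \<in> \<Omega>" by (simp add: algebra_simps)
    qed
    then show ?thesis by (intro enn2real_leI) auto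
  qed
  have 7: "integrable lborel (\<lambda>s. (f (?line s))\<^sup>2 * dir_weight_real e (?line s))"
  proof -
    obtain B where B: "\<And>x e. x \<in> K \<Longrightarrow> norm e = 1 \<Longrightarrow> \<bar>(f x)\<^sup>2 * dir_weight_real e x\<bar> \<le> B"
      by (rule f_sq_weight_bound) blast
    have [measurable]: "f \<in> borel_measurable borel" by (intro borel_measurable_continuous_onI continuous_on_f)
    have [measurable]: "?line \<in> borel_measurable borel"
      by (intro borel_measurable_continuous_onI continuous_intros)
    show ?thesis
      by (rule integrable_lborel_bounded_compact_support[OF _ 3, of _ B]) (use B e K(3) in auto)
  qed
  note H = hardy_open_set[OF 1 2 3 4 _ 5 6 7 l n, folded dir_density_def]
  show "0 \<le> (LINT s|lborel. dir_density e (x + s *\<^sub>R e))"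
    using H(1) K(3) by auto
  show "\<bar>f (x + s *\<^sub>R e)\<bar> ^ Suc n \<le> (2 * n + 3) *
      (l * (LINT s|lborel. f (x + s *\<^sub>R e) ^ (2 * n)) + (LINT s|lborel. dir_density e (x + s *\<^sub>R e)) / l)"
    using H(2) K(3) by auto
  show "integrable lborel (\<lambda>s. f (x + s *\<^sub>R e) ^ (2 * n))"
    by (rule integrable_lborel_continuous_compact_support[OF _ 3])
      (use n K(3) in \<open>auto intro!: continuous_intros continuous_on_compose2[OF continuous_on_f[of UNIV]]\<close>)
  have "integrable lborel (\<lambda>s. (Df (?line s) e)\<^sup>2)"
    by (rule integrable_lborel_continuous_compact_support[OF _ 3])
      (auto intro!: continuous_intros 2 simp: Df_eq_0)
  then show "integrable lborel (\<lambda>s. dir_density e (x + s *\<^sub>R e))"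
    unfolding dir_density_def using 7 by (intro Bochner_Integration.integrable_diff) auto
qed

text \<open>One factor \<open>|f|\<^sup>n\<^sup>+\<^sup>1\<close> is bounded by a function of the coordinate along \<open>e'\<close> only, the other one by a function of the
coordinate along \<open>e\<close> only. The integral of the product of these two functions factorises.\<close>

lemma planar_product_bound:
  fixes b1 b2 e :: 'a and l :: real and n :: nat
  assumes basis: "Basis = {b1, b2}" "b1 \<noteq> b2" and e: "norm e = 1" and l: "l > 0" and n: "n > 0"
  defines "e' \<equiv> quarter_turn b1 b2 e"
  shows "0 \<le> (LINT x|lborel. dir_density e x)" "0 \<le> (LINT x|lborel. dir_density e' x)"
    and "(LINT x|lborel. f x ^ (2 * Suc n)) \<le> (2 * n + 3)\<^sup>2 *
      ((l * (LINT x|lborel. f x ^ (2 * n)) + (LINT x|lborel. dir_density e x) / l) *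
       (l * (LINT x|lborel. f x ^ (2 * n)) + (LINT x|lborel. dir_density e' x) / l))"
proof -
  define T where "T p = fst p *\<^sub>R e + snd p *\<^sub>R e'" for p
  define H where "H u x = l * f x ^ (2 * n) + dir_density u x / l" for u x
  define P where "P = real (2 * n + 3)"
  have e': "norm e' = 1" unfolding e'_def using e norm_quarter_turn[OF basis] by simp
  have T_meas[measurable]: "T \<in> borel_measurable borel"
    unfolding T_def by (intro borel_measurable_continuous_onI continuous_intros)
  have distr: "distr lborel borel T = lborel"
    unfolding T_def e'_def by (rule distr_lborel_orthonormal_frame[OF basis e])
  have int_T: "integrable (lborel \<Otimes>\<^sub>M lborel) (\<lambda>(s, r). g (T (s, r)))"
    and LINT_T: "(LINT p|(lborel \<Otimes>\<^sub>M lborel). g (T p)) = (LINT x|lborel. g x)"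
    if g: "integrable lborel g" for g :: "'a \<Rightarrow> real"
  proof -
    have "integrable (distr lborel borel T) g" using g by (simp add: distr)
    then have "integrable lborel (\<lambda>p. g (T p))"
      by (subst (asm) integrable_distr_eq) (use g in auto)
    then show "integrable (lborel \<Otimes>\<^sub>M lborel) (\<lambda>(s, r). g (T (s, r)))"
      by (simp add: lborel_prod case_prod_unfold)
    show "(LINT p|(lborel \<Otimes>\<^sub>M lborel). g (T p)) = (LINT x|lborel. g x)"
      unfolding lborel_prod by (subst distr[symmetric], subst integral_distr) (use g in auto)
  qed
  have int_H: "integrable lborel (H u)" if "norm u = 1" for u
    unfolding H_def using integrable_dir_density[OF that] integrable_power n by (intro Bochner_Integration.integrable_add) auto
  have LINT_H: "(LINT x|lborel. H u x) = l * (LINT x|lborel. f x ^ (2 * n)) + (LINT x|lborel. dir_density u x) / l"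
    if "norm u = 1" for u
    unfolding H_def using integrable_dir_density[OF that] integrable_power[of "2 * n"] n by simp
  define a where "a r = (LINT s|lborel. H e (T (s, r)))" for r
  define b where "b s = (LINT r|lborel. H e' (T (s, r)))" for s
  have a: "integrable lborel a" "(LINT r|lborel. a r) = (LINT x|lborel. H e x)"
    unfolding a_def using lborel_pair.integrable_snd[OF int_T[OF int_H[OF e]]]
      lborel_pair.integral_snd[OF int_T[OF int_H[OF e]]] LINT_T[OF int_H[OF e]] by (auto simp: case_prod_unfold)
  have b: "integrable lborel b" "(LINT s|lborel. b s) = (LINT x|lborel. H e' x)"
    unfolding b_def using lborel_pair.integrable_fst[OF int_T[OF int_H[OF e']]]
      lborel_pair.integral_fst[OF int_T[OF int_H[OF e']]] LINT_T[OF int_H[OF e']] by (auto simp: case_prod_unfold)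
  have T_line: "T (s, r) = r *\<^sub>R e' + s *\<^sub>R e" for s r by (simp add: T_def)
  have T_line': "T (s, r) = s *\<^sub>R e + r *\<^sub>R e'" for s r by (simp add: T_def)
  have fa: "\<bar>f (T (s, r))\<bar> ^ Suc n \<le> P * a r" and a0: "0 \<le> a r" for s r
  proof -
    note L = hardy_on_line[OF e l n, of "r *\<^sub>R e'"]
    have a_eq: "a r = l * (LINT s|lborel. f (r *\<^sub>R e' + s *\<^sub>R e) ^ (2 * n)) + (LINT s|lborel. dir_density e (r *\<^sub>R e' + s *\<^sub>R e)) / l"
      unfolding a_def H_def T_line using L(3,4) by simp
    show "\<bar>f (T (s, r))\<bar> ^ Suc n \<le> P * a r"
      using L(2) unfolding a_eq P_def T_line .
    show "0 \<le> a r" unfolding a_eq using L(1) l by simp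
  qed
  have fb: "\<bar>f (T (s, r))\<bar> ^ Suc n \<le> P * b s" and b0: "0 \<le> b s" for s r
  proof -
    note L = hardy_on_line[OF e' l n, of "s *\<^sub>R e"]
    have b_eq: "b s = l * (LINT r|lborel. f (s *\<^sub>R e + r *\<^sub>R e') ^ (2 * n)) + (LINT r|lborel. dir_density e' (s *\<^sub>R e + r *\<^sub>R e')) / l"
      unfolding b_def H_def T_line' using L(3,4) by simp
    show "\<bar>f (T (s, r))\<bar> ^ Suc n \<le> P * b s"
      using L(2) unfolding b_eq P_def T_line' .
    show "0 \<le> b s" unfolding b_eq using L(1) l by simp
  qed
  have H0: "0 \<le> (LINT x|lborel. H e x)" "0 \<le> (LINT x|lborel. H e' x)"
    unfolding a(2)[symmetric] b(2)[symmetric] using a0 b0 by (auto intro!: integral_nonneg_AE)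
  have P0: "P \<ge> 0" by (simp add: P_def)
  have [measurable]: "f \<in> borel_measurable borel" by (intro borel_measurable_continuous_onI continuous_on_f)
  have [measurable]: "a \<in> borel_measurable lborel" "b \<in> borel_measurable lborel" using a(1) b(1) by auto

  have "ennreal (LINT x|lborel. f x ^ (2 * Suc n)) = (\<integral>\<^sup>+x. ennreal (f x ^ (2 * Suc n)) \<partial>lborel)"
    by (rule nn_integral_eq_integral[OF integrable_power, symmetric]) (auto simp: power_even_eq simp del: mult_Suc_right)
  also have "\<dots> = (\<integral>\<^sup>+p. ennreal (f (T p) ^ (2 * Suc n)) \<partial>(lborel \<Otimes>\<^sub>M lborel))"
    unfolding T_def e'_def lborel_prod by (rule nn_integral_orthonormal_frame[OF basis e, symmetric]) simp
  also have "\<dots> \<le> (\<integral>\<^sup>+p. ennreal (P * b (fst p)) * ennreal (P * a (snd p)) \<partial>(lborel \<Otimes>\<^sub>M lborel))"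
  proof (rule nn_integral_mono)
    fix p
    have "f (T p) ^ (2 * Suc n) = \<bar>f (T p)\<bar> ^ Suc n * \<bar>f (T p)\<bar> ^ Suc n"
      using power_even_abs[of "2 * Suc n" "f (T p)", OF dvd_triv_left] by (simp only: power_add[symmetric] mult_2[symmetric])
    also have "\<dots> \<le> (P * b (fst p)) * (P * a (snd p))"
      using fa[of "fst p" "snd p"] fb[of "fst p" "snd p"] P0 b0 by (intro mult_mono) auto
    finally show "ennreal (f (T p) ^ (2 * Suc n)) \<le> ennreal (P * b (fst p)) * ennreal (P * a (snd p))"
      using P0 a0 b0 by (simp add: ennreal_mult[symmetric] ennreal_leI)
  qed
  also have "\<dots> = (\<integral>\<^sup>+s. ennreal (P * b s) \<partial>lborel) * (\<integral>\<^sup>+r. ennreal (P * a r) \<partial>lborel)"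
    by (subst lborel.nn_integral_fst[symmetric]) (simp_all add: nn_integral_cmult nn_integral_multc)
  also have "\<dots> = ennreal (P * (LINT s|lborel. b s)) * ennreal (P * (LINT r|lborel. a r))"
    using a(1) b(1) a0 b0 P0 by (simp add: nn_integral_eq_integral)
  also have "\<dots> = ennreal (P\<^sup>2 * ((LINT x|lborel. H e x) * (LINT x|lborel. H e' x)))"
    using H0 P0 by (subst ennreal_mult[symmetric]) (auto simp: a(2) b(2) power2_eq_square mult_ac)
  finally show "(LINT x|lborel. f x ^ (2 * Suc n)) \<le> (2 * n + 3)\<^sup>2 *
      ((l * (LINT x|lborel. f x ^ (2 * n)) + (LINT x|lborel. dir_density e x) / l) *
       (l * (LINT x|lborel. f x ^ (2 * n)) + (LINT x|lborel. dir_density e' x) / l))"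
    using H0 unfolding LINT_H[OF e, symmetric] LINT_H[OF e', symmetric] P_def
    by (subst (asm) ennreal_le_iff) auto
  show "0 \<le> (LINT x|lborel. dir_density e x)"
  proof -
    have "(LINT x|lborel. dir_density e x) = (LINT r|lborel. LINT s|lborel. dir_density e (T (s, r)))"
      using lborel_pair.integral_snd[OF int_T[OF integrable_dir_density[OF e]]] LINT_T[OF integrable_dir_density[OF e]]
      by (auto simp: case_prod_unfold)
    also have "\<dots> \<ge> 0" unfolding T_line using hardy_on_line(1)[OF e l n] by (intro integral_nonneg_AE) auto
    finally show ?thesis .
  qed
  show "0 \<le> (LINT x|lborel. dir_density e' x)"
  proof -
    have "(LINT x|lborel. dir_density e' x) = (LINT s|lborel. LINT r|lborel. dir_density e' (T (s, r)))"
      using lborel_pair.integral_fst[OF int_T[OF integrable_dir_density[OF e']]] LINT_T[OF integrable_dir_density[OF e']]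
      by (auto simp: case_prod_unfold)
    also have "\<dots> \<ge> 0" unfolding T_line' using hardy_on_line(1)[OF e' l n] by (intro integral_nonneg_AE) auto
    finally show ?thesis .
  qed
qed

lemma nn_integral_f_sq_weight:
  assumes e: "norm e = 1"
  shows "(\<integral>\<^sup>+x. ennreal ((f x)\<^sup>2) * dir_weight \<Omega> e x \<partial>lborel) =
    ennreal (4 * ((LINT x|lborel. (Df x e)\<^sup>2) - (LINT x|lborel. dir_density e x)))"
proof -
  obtain B where B: "B \<ge> 0" "\<And>x e. x \<in> K \<Longrightarrow> norm e = 1 \<Longrightarrow> dir_weight \<Omega> e x \<le> ennreal B"
    using dir_weight_bounded_on_support by blast
  have "ennreal ((f x)\<^sup>2) * dir_weight \<Omega> e x = ennreal ((f x)\<^sup>2 * dir_weight_real e x)" for x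
  proof (cases "x \<in> K")
    case True
    then have "dir_weight \<Omega> e x < top" using B(2)[OF True e] by (auto intro: le_less_trans)
    then show ?thesis by (simp add: ennreal_mult)
  qed (simp add: K(3))
  then have "(\<integral>\<^sup>+x. ennreal ((f x)\<^sup>2) * dir_weight \<Omega> e x \<partial>lborel)
      = (\<integral>\<^sup>+x. ennreal ((f x)\<^sup>2 * dir_weight_real e x) \<partial>lborel)" by simp
  also have "\<dots> = ennreal (LINT x|lborel. (f x)\<^sup>2 * dir_weight_real e x)"
    by (rule nn_integral_eq_integral[OF integrable_f_sq_dir_weight[OF e]]) auto
  also have "(LINT x|lborel. dir_density e x) = (LINT x|lborel. (Df x e)\<^sup>2) - (LINT x|lborel. (f x)\<^sup>2 * dir_weight_real e x) / 4"
    unfolding dir_density_def using integrable_deriv_sq integrable_f_sq_dir_weight[OF e] by simp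
  then have "(LINT x|lborel. (f x)\<^sup>2 * dir_weight_real e x) = 4 * ((LINT x|lborel. (Df x e)\<^sup>2) - (LINT x|lborel. dir_density e x))"
    by simp
  finally show ?thesis .
qed

text \<open>The product bound is turned into an upper bound for an integral that is linear in the directional weights; this is the
form that can be averaged over frames. The second claim ensures that the real number inside
\<open>ennreal\<close> is nonnegative, so that nothing is lost in the truncation.\<close>

lemma planar_frame_bound:
  fixes b1 b2 e :: 'a and l :: real and n :: nat
  assumes basis: "Basis = {b1, b2}" "b1 \<noteq> b2" and e: "norm e = 1" and l: "l > 0" and n: "n > 0"
  shows "(\<integral>\<^sup>+x. ennreal ((f x)\<^sup>2) * (dir_weight \<Omega> e x + dir_weight \<Omega> (quarter_turn b1 b2 e) x) \<partial>lborel)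
    \<le> ennreal (4 * ((LINT x|lborel. (\<Sum>b\<in>Basis. (Df x b)\<^sup>2)) -
        l * (sqrt (LINT x|lborel. f x ^ (2 * Suc n)) / (2 * n + 3) - l * (LINT x|lborel. f x ^ (2 * n)))))"
    and "l * (sqrt (LINT x|lborel. f x ^ (2 * Suc n)) / (2 * n + 3) - l * (LINT x|lborel. f x ^ (2 * n)))
      \<le> (LINT x|lborel. (\<Sum>b\<in>Basis. (Df x b)\<^sup>2))"
proof -
  define e' where "e' = quarter_turn b1 b2 e"
  define M where "M = (LINT x|lborel. f x ^ (2 * Suc n))"
  define A where "A = (LINT x|lborel. f x ^ (2 * n))"
  define G where "G = (LINT x|lborel. (\<Sum>b\<in>Basis. (Df x b)\<^sup>2))"
  define E where "E u = (LINT x|lborel. dir_density u x)" for u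
  define P where "P = real (2 * n + 3)"
  have P: "P > 0" by (simp add: P_def)
  have e': "norm e' = 1" unfolding e'_def using e norm_quarter_turn[OF basis] by simp
  note prod = planar_product_bound[OF basis e l n, folded e'_def, folded M_def A_def E_def P_def]
  have A0: "A \<ge> 0" unfolding A_def by (rule integral_nonneg_AE) auto
  have "M \<le> P\<^sup>2 * ((l * A + (E e + E e') / l) * (l * A + (E e + E e') / l))"
    using prod l A0 by (elim order_trans) (intro mult_mono add_left_mono divide_right_mono, auto simp: P_def)
  also have "\<dots> = (P * (l * A + (E e + E e') / l))\<^sup>2" by (simp add: power2_eq_square mult_ac)
  finally have "sqrt M \<le> P * (l * A + (E e + E e') / l)"
    using prod l A0 P by (intro real_le_lsqrt) auto
  then have "sqrt M / P \<le> l * A + (E e + E e') / l"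
    using P by (simp add: divide_le_eq mult.commute)
  then have "l * (sqrt M / P) \<le> l * (l * A + (E e + E e') / l)"
    using l by (intro mult_left_mono) auto
  also have "\<dots> = l * (l * A) + (E e + E e')" using l by (simp add: field_simps)
  finally have E_ge: "l * (sqrt M / P - l * A) \<le> E e + E e'" by (simp add: right_diff_distrib)

  have G: "G = (LINT x|lborel. (Df x e)\<^sup>2) + (LINT x|lborel. (Df x e')\<^sup>2)"
    unfolding G_def e'_def Bochner_Integration.integral_add[OF integrable_deriv_sq integrable_deriv_sq, symmetric]
    using sum_squares_orthonormal_frame[OF basis has_derivative_linear[OF deriv] e]
    by (intro Bochner_Integration.integral_cong) auto
  have [measurable]: "f \<in> borel_measurable borel" by (intro borel_measurable_continuous_onI continuous_on_f)
  have [measurable]: "dir_weight \<Omega> u \<in> borel_measurable borel" for u using dir_weight_measurable[OF \<Omega>] .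
  have nonneg: "0 \<le> (LINT x|lborel. (Df x u)\<^sup>2) - E u" if "norm u = 1" for u
  proof -
    have "(LINT x|lborel. (f x)\<^sup>2 * dir_weight_real u x) \<ge> 0" by (rule integral_nonneg_AE) auto
    then show ?thesis unfolding E_def dir_density_def using integrable_deriv_sq integrable_f_sq_dir_weight[OF that] by simp
  qed
  have "(\<integral>\<^sup>+x. ennreal ((f x)\<^sup>2) * (dir_weight \<Omega> e x + dir_weight \<Omega> e' x) \<partial>lborel)
    = ennreal (4 * ((LINT x|lborel. (Df x e)\<^sup>2) - E e)) + ennreal (4 * ((LINT x|lborel. (Df x e')\<^sup>2) - E e'))"
    unfolding E_def nn_integral_f_sq_weight[OF e, symmetric] nn_integral_f_sq_weight[OF e', symmetric]
    by (subst nn_integral_add[symmetric]) (auto simp: distrib_left)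
  also have "\<dots> = ennreal (4 * (G - (E e + E e')))"
    using nonneg[OF e] nonneg[OF e'] unfolding G
    by (subst ennreal_plus[symmetric]) (auto simp: algebra_simps)
  also have "\<dots> \<le> ennreal (4 * (G - l * (sqrt M / P - l * A)))"
    using E_ge by (intro ennreal_leI) simp
  finally show "(\<integral>\<^sup>+x. ennreal ((f x)\<^sup>2) * (dir_weight \<Omega> e x + dir_weight \<Omega> (quarter_turn b1 b2 e) x) \<partial>lborel)
    \<le> ennreal (4 * ((LINT x|lborel. (\<Sum>b\<in>Basis. (Df x b)\<^sup>2)) -
        l * (sqrt (LINT x|lborel. f x ^ (2 * Suc n)) / (2 * n + 3) - l * (LINT x|lborel. f x ^ (2 * n)))))"
    unfolding e'_def M_def A_def G_def P_def by simp
  have "l * (sqrt M / P - l * A) \<le> G"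
    using E_ge nonneg[OF e] nonneg[OF e'] unfolding G by linarith
  then show "l * (sqrt (LINT x|lborel. f x ^ (2 * Suc n)) / (2 * n + 3) - l * (LINT x|lborel. f x ^ (2 * n)))
      \<le> (LINT x|lborel. (\<Sum>b\<in>Basis. (Df x b)\<^sup>2))"
    unfolding M_def A_def G_def P_def .
qed

text \<open>On a one-dimensional space there is a single line, and the pointwise bound for \<open>f\<close> plays the part of the
bound for the integral of \<open>f\<^sup>2\<^sup>n\<^sup>+\<^sup>2\<close> in the plane.\<close>

lemma one_dim_frame_bound:
  fixes b e x :: 'a and l :: real
  assumes basis: "Basis = {b}" and e: "norm e = 1" and l: "l > 0"
  shows "(\<integral>\<^sup>+x. ennreal ((f x)\<^sup>2) * dir_weight \<Omega> e x \<partial>lborel)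
    \<le> ennreal (4 * ((LINT x|lborel. (\<Sum>b\<in>Basis. (Df x b)\<^sup>2)) -
        l * ((f x)\<^sup>2 / 5 - l * (LINT x|lborel. (f x)\<^sup>2))))"
    and "l * ((f x)\<^sup>2 / 5 - l * (LINT x|lborel. (f x)\<^sup>2)) \<le> (LINT x|lborel. (\<Sum>b\<in>Basis. (Df x b)\<^sup>2))"
proof -
  have b: "norm b = 1" by (rule norm_Basis) (simp add: basis)
  have rep: "(y \<bullet> b) *\<^sub>R b = y" for y :: 'a
    using euclidean_representation[of y] unfolding basis by simp
  obtain c where c: "e = c *\<^sub>R b" "\<bar>c\<bar> = 1"
    using rep[of e] e b by (metis norm_scaleR mult.right_neutral)
  then have c2: "c * c = 1" by (metis abs_mult_self_eq mult_1)
  have coord: "(\<lambda>s. s *\<^sub>R e) \<in> borel_measurable borel"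
    by (intro borel_measurable_continuous_onI continuous_intros)
  have distr: "distr lborel borel (\<lambda>s. s *\<^sub>R e) = (lborel :: 'a measure)"
  proof (rule lborel_eqI[symmetric])
    fix p q :: 'a assume pq: "\<And>b. b \<in> Basis \<Longrightarrow> p \<bullet> b \<le> q \<bullet> b"
    have bb: "b \<bullet> b = 1" using b by (simp add: dot_square_norm)
    have "(\<lambda>s. s *\<^sub>R e) -` box p q = (\<lambda>s. c * s) -` {p \<bullet> b<..<q \<bullet> b}"
      by (auto simp: box_def basis c bb mult.commute)
    then have "emeasure (distr lborel borel (\<lambda>s. s *\<^sub>R e)) (box p q)
        = emeasure lborel ((\<lambda>s. c * s) -` {p \<bullet> b<..<q \<bullet> b})"
      using coord by (subst emeasure_distr) auto
    also have "\<dots> = emeasure (distr lborel borel ((*) c)) {p \<bullet> b<..<q \<bullet> b}"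
      by (subst emeasure_distr) auto
    also have "distr lborel borel ((*) c) = (lborel :: real measure)"
      using c(2) by (subst lborel_distr_mult) (auto simp: density_1)
    finally show "emeasure (distr lborel borel (\<lambda>s. s *\<^sub>R e)) (box p q) = (\<Prod>b\<in>Basis. (q - p) \<bullet> b)"
      using pq by (simp add: basis inner_diff_left)
  qed simp
  have LINT: "(LINT s|lborel. g (0 + s *\<^sub>R e)) = (LINT x|lborel. g x)" if "integrable lborel g" for g :: "'a \<Rightarrow> real"
    using coord that by (subst distr[symmetric], subst integral_distr) auto
  define E where "E = (LINT x|lborel. dir_density e x)"
  have x: "0 + (c * (x \<bullet> b)) *\<^sub>R e = x"
  proof -
    have "(c * (x \<bullet> b)) *\<^sub>R e = (c * c * (x \<bullet> b)) *\<^sub>R b"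
      unfolding c(1) by (simp only: scaleR_scaleR mult_ac)
    then show ?thesis using c2 rep[of x] by simp
  qed
  have "(f x)\<^sup>2 \<le> 5 * (l * (LINT x|lborel. (f x)\<^sup>2) + E / l)"
    using hardy_on_line(2)[OF e l, where x = 0 and n = 1 and s = "c * (x \<bullet> b)", unfolded x]
      LINT[OF integrable_dir_density[OF e]] LINT[OF integrable_power[of 2]] by (simp add: E_def power2_eq_square)
  then have "(f x)\<^sup>2 / 5 \<le> l * (LINT x|lborel. (f x)\<^sup>2) + E / l"
    by (subst divide_le_eq) (simp add: mult.commute)
  then have "l * ((f x)\<^sup>2 / 5) \<le> l * (l * (LINT x|lborel. (f x)\<^sup>2) + E / l)"
    using l by (intro mult_left_mono) auto
  also have "\<dots> = l * (l * (LINT x|lborel. (f x)\<^sup>2)) + E" using l by (simp add: field_simps)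
  finally have E: "l * ((f x)\<^sup>2 / 5 - l * (LINT x|lborel. (f x)\<^sup>2)) \<le> E"
    by (simp add: right_diff_distrib)
  have D: "(Df x e)\<^sup>2 = (\<Sum>b\<in>Basis. (Df x b)\<^sup>2)" for x
  proof -
    have "Df x e = c * Df x b" using has_derivative_linear[OF deriv] c by (simp add: linear_scale)
    then show ?thesis using c2 by (simp add: basis power2_eq_square)
  qed
  show "(\<integral>\<^sup>+x. ennreal ((f x)\<^sup>2) * dir_weight \<Omega> e x \<partial>lborel)
    \<le> ennreal (4 * ((LINT x|lborel. (\<Sum>b\<in>Basis. (Df x b)\<^sup>2)) -
        l * ((f x)\<^sup>2 / 5 - l * (LINT x|lborel. (f x)\<^sup>2))))"
    unfolding nn_integral_f_sq_weight[OF e] using E by (intro ennreal_leI) (simp add: E_def D)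
  have "0 \<le> (LINT x|lborel. (f x)\<^sup>2 * dir_weight_real e x)" by (rule integral_nonneg_AE) auto
  then have "E \<le> (LINT x|lborel. (Df x e)\<^sup>2)"
    unfolding E_def dir_density_def using integrable_deriv_sq integrable_f_sq_dir_weight[OF e] by simp
  then show "l * ((f x)\<^sup>2 / 5 - l * (LINT x|lborel. (f x)\<^sup>2)) \<le> (LINT x|lborel. (\<Sum>b\<in>Basis. (Df x b)\<^sup>2))"
    using E by (simp add: D)
qed

definition hardy_energy :: real where
  "hardy_energy =
     (LINT x|lborel. (\<Sum>b\<in>Basis. (Df x b)\<^sup>2) - (f x)\<^sup>2 * enn2real (mean_dir_weight \<Omega> x) / 4)"


lemma mean_dir_weight_bounded_on_support:
  obtains B where "B \<ge> 0" "\<And>x. x \<in> K \<Longrightarrow> mean_dir_weight \<Omega> x \<le> ennreal B"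
proof -
  obtain B where B: "B \<ge> 0" "\<And>x e. x \<in> K \<Longrightarrow> norm e = 1 \<Longrightarrow> dir_weight \<Omega> e x \<le> ennreal B"
    using dir_weight_bounded_on_support by blast
  have "mean_dir_weight \<Omega> x \<le> ennreal (real DIM('a) * B)" if "x \<in> K" for x
    using mean_dir_weight_le[OF \<Omega> B(2)[OF that]] B(1)
    by (simp add: ennreal_mult ennreal_of_nat_eq_real_of_nat)
  then show ?thesis using B(1) by (intro that[of "real DIM('a) * B"]) auto
qed

lemma mean_dir_weight_finite: "x \<in> K \<Longrightarrow> mean_dir_weight \<Omega> x < top"
  by (rule mean_dir_weight_bounded_on_support) (meson ennreal_less_top le_less_trans)

lemma integrable_f_sq_mean_dir_weight:
  "integrable lborel (\<lambda>x. (f x)\<^sup>2 * enn2real (mean_dir_weight \<Omega> x))"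
proof -
  obtain B where B: "B \<ge> 0" "\<And>x. x \<in> K \<Longrightarrow> mean_dir_weight \<Omega> x \<le> ennreal B"
    by (rule mean_dir_weight_bounded_on_support) blast
  have cont: "continuous_on S f" for S by (rule continuous_on_f)
  have "bounded (f ` K)" using cont K(1) by (intro compact_imp_bounded compact_continuous_image)
  then obtain C where C: "\<And>x. x \<in> K \<Longrightarrow> \<bar>f x\<bar> \<le> C" by (auto simp: bounded_real)
  have [measurable]: "f \<in> borel_measurable borel" by (intro borel_measurable_continuous_onI cont)
  note mean_dir_weight_measurable[OF \<Omega>, measurable]
  show ?thesis
  proof (rule integrable_lborel_bounded_compact_support[OF _ K(1)])
    fix x assume x: "x \<in> K"
    have "(f x)\<^sup>2 \<le> C\<^sup>2" using C[OF x] by (metis abs_le_square_iff abs_ge_self order_trans)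
    moreover have "enn2real (mean_dir_weight \<Omega> x) \<le> B" using B(2)[OF x] B(1) enn2real_leI by blast
    ultimately show "\<bar>(f x)\<^sup>2 * enn2real (mean_dir_weight \<Omega> x)\<bar> \<le> C\<^sup>2 * B"
      by (simp add: abs_mult mult_mono)
  qed (use K(3) in auto)
qed

lemma integrable_grad: "integrable lborel (\<lambda>x. \<Sum>b\<in>Basis. (Df x b)\<^sup>2)"
  using integrable_deriv_sq by (intro Bochner_Integration.integrable_sum) auto

lemma integrable_hardy_density:
  "integrable lborel (\<lambda>x. (\<Sum>b\<in>Basis. (Df x b)\<^sup>2) - (f x)\<^sup>2 * enn2real (mean_dir_weight \<Omega> x) / 4)"
  using integrable_grad integrable_f_sq_mean_dir_weight by (intro Bochner_Integration.integrable_diff) auto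

lemma hardy_energy_ge:
  assumes "(\<integral>\<^sup>+x. ennreal ((f x)\<^sup>2) * mean_dir_weight \<Omega> x \<partial>lborel)
      \<le> ennreal (4 * ((LINT x|lborel. (\<Sum>b\<in>Basis. (Df x b)\<^sup>2)) - c))"
    and "c \<le> (LINT x|lborel. (\<Sum>b\<in>Basis. (Df x b)\<^sup>2))"
  shows "c \<le> hardy_energy"
proof -
  have "ennreal ((f x)\<^sup>2) * mean_dir_weight \<Omega> x = ennreal ((f x)\<^sup>2 * enn2real (mean_dir_weight \<Omega> x))" for x
    using mean_dir_weight_finite[of x] K(3)[of x] by (cases "x \<in> K") (auto simp: ennreal_mult)
  then have "(\<integral>\<^sup>+x. ennreal ((f x)\<^sup>2) * mean_dir_weight \<Omega> x \<partial>lborel)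
      = ennreal (LINT x|lborel. (f x)\<^sup>2 * enn2real (mean_dir_weight \<Omega> x))"
    by (simp add: nn_integral_eq_integral[OF integrable_f_sq_mean_dir_weight])
  with assms have "(LINT x|lborel. (f x)\<^sup>2 * enn2real (mean_dir_weight \<Omega> x))
      \<le> 4 * ((LINT x|lborel. (\<Sum>b\<in>Basis. (Df x b)\<^sup>2)) - c)"
    by (simp add: ennreal_le_iff)
  then show ?thesis
    unfolding hardy_energy_def using integrable_grad integrable_f_sq_mean_dir_weight by simp
qed

lemma f_sq_measurable: "(\<lambda>x. ennreal ((f x)\<^sup>2)) \<in> borel_measurable borel"
proof -
  have [measurable]: "f \<in> borel_measurable borel"
    by (intro borel_measurable_continuous_onI continuous_on_f)
  show ?thesis by measurable
qed

text \<open>After averaging over frames, the quadratic family of bounds in \<open>l\<close> holds with the full energy on the right-hand side.\<close>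

lemma hardy_planar:
  fixes b1 b2 :: 'a and n :: nat
  assumes basis: "Basis = {b1, b2}" "b1 \<noteq> b2" and n: "n > 0"
  shows "0 \<le> hardy_energy"
    and "(LINT x|lborel. f x ^ (2 * Suc n))
      \<le> 4 * (real (2 * n + 3))\<^sup>2 * hardy_energy * (LINT x|lborel. f x ^ (2 * n))"
proof -
  define M where "M = (LINT x|lborel. f x ^ (2 * Suc n))"
  define A where "A = (LINT x|lborel. f x ^ (2 * n))"
  define P where "P = real (2 * n + 3)"
  have b1: "norm b1 = 1" by (rule norm_Basis) (simp add: basis)
  have M0: "M \<ge> 0" unfolding M_def by (rule integral_nonneg_AE) (auto simp: power_even_eq simp del: mult_Suc_right)
  have A0: "A \<ge> 0" unfolding A_def by (rule integral_nonneg_AE) auto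
  have P: "P > 0" by (simp add: P_def)
  have "l * (sqrt M / P - l * A) \<le> hardy_energy" if l: "l > 0" for l
  proof (rule hardy_energy_ge)
    note frame = planar_frame_bound[OF basis _ l n, folded M_def A_def P_def]
    show "(\<integral>\<^sup>+x. ennreal ((f x)\<^sup>2) * mean_dir_weight \<Omega> x \<partial>lborel)
      \<le> ennreal (4 * ((LINT x|lborel. (\<Sum>b\<in>Basis. (Df x b)\<^sup>2)) - l * (sqrt M / P - l * A)))"
      by (rule nn_integral_mean_dir_weight_le_planar[OF basis \<Omega> f_sq_measurable frame(1)])
    show "l * (sqrt M / P - l * A) \<le> (LINT x|lborel. (\<Sum>b\<in>Basis. (Df x b)\<^sup>2))"
      by (rule frame(2)[OF b1])
  qed
  note Q = nonneg_and_square_le_of_quadratic_family[OF A0 _ this]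
  show "0 \<le> hardy_energy" by (rule Q(1)) (use M0 P in auto)
  have "(sqrt M / P)\<^sup>2 \<le> 4 * A * hardy_energy" by (rule Q(2)) (use M0 P in auto)
  then have "M \<le> 4 * P\<^sup>2 * hardy_energy * A"
    using M0 P by (simp add: power_divide divide_le_eq mult_ac)
  then show "(LINT x|lborel. f x ^ (2 * Suc n))
      \<le> 4 * (real (2 * n + 3))\<^sup>2 * hardy_energy * (LINT x|lborel. f x ^ (2 * n))"
    by (simp only: M_def A_def P_def)
qed

lemma hardy_one_dim:
  assumes dim: "DIM('a) = 1"
  shows "0 \<le> hardy_energy"
    and "(f x) ^ 4 \<le> 100 * hardy_energy * (LINT x|lborel. (f x)\<^sup>2)"
proof -
  obtain b :: 'a where basis: "Basis = {b}" using dim card_1_singletonE by blast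
  define A where "A = (LINT x|lborel. (f x)\<^sup>2)"
  have b: "norm b = 1" by (rule norm_Basis) (simp add: basis)
  have A0: "A \<ge> 0" unfolding A_def by (rule integral_nonneg_AE) auto
  have "l * ((f x)\<^sup>2 / 5 - l * A) \<le> hardy_energy" if l: "l > 0" for l
  proof (rule hardy_energy_ge)
    note frame = one_dim_frame_bound[OF basis _ l, folded A_def]
    show "(\<integral>\<^sup>+x. ennreal ((f x)\<^sup>2) * mean_dir_weight \<Omega> x \<partial>lborel)
      \<le> ennreal (4 * ((LINT x|lborel. (\<Sum>b\<in>Basis. (Df x b)\<^sup>2)) - l * ((f x)\<^sup>2 / 5 - l * A)))"
      by (rule nn_integral_mean_dir_weight_le_one_dim[OF dim \<Omega> f_sq_measurable frame(1)])
    show "l * ((f x)\<^sup>2 / 5 - l * A) \<le> (LINT x|lborel. (\<Sum>b\<in>Basis. (Df x b)\<^sup>2))"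
      by (rule frame(2)[OF b])
  qed
  note Q = nonneg_and_square_le_of_quadratic_family[OF A0 _ this]
  show "0 \<le> hardy_energy" by (rule Q(1)) auto
  have "((f x)\<^sup>2 / 5)\<^sup>2 \<le> 4 * A * hardy_energy" by (rule Q(2)) auto
  then show "(f x) ^ 4 \<le> 100 * hardy_energy * (LINT x|lborel. (f x)\<^sup>2)"
    by (simp add: A_def power_divide mult_ac)
qed

lemma integrable_powr:
  assumes "p > 0" shows "integrable lborel (\<lambda>x. \<bar>f x\<bar> powr p)"
proof (rule integrable_lborel_continuous_compact_support[OF _ K(1)])
  show "continuous_on UNIV (\<lambda>x. \<bar>f x\<bar> powr p)"
    using assms by (intro continuous_on_powr' continuous_on_rabs continuous_on_f continuous_on_const) auto
qed (use K(3) in auto)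

text \<open>Interpolating the lower power \<open>f\<^sup>2\<^sup>n\<close> on the right-hand side of the planar Hardy bound allows the integral \<open>M\<close> of \<open>f\<^sup>2\<^sup>n\<^sup>+\<^sup>2\<close> to be
absorbed into the left-hand side. The parameter \<open>s\<close> need only dominate the energy, so that one \<open>s\<close> can serve
both the real and the imaginary part and vanishing energy is not excluded.\<close>

lemma gagliardo_nirenberg_planar_real:
  fixes b1 b2 :: 'a and n :: nat and q s :: real
  assumes basis: "Basis = {b1, b2}" "b1 \<noteq> b2" and n: "n > 0" and q: "2 \<le> q" "q \<le> 2 * n + 2"
    and s: "s > 0" "8 * (real (2 * n + 3))\<^sup>2 * hardy_energy \<le> s\<^sup>2"
  shows "(LINT x|lborel. \<bar>f x\<bar> powr q) \<le> 2 * s powr (q - 2) * (LINT x|lborel. (f x)\<^sup>2)"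
proof -
  define M where "M = (LINT x|lborel. f x ^ (2 * Suc n))"
  define A where "A = (LINT x|lborel. f x ^ (2 * n))"
  define X where "X = (LINT x|lborel. (f x)\<^sup>2)"
  define E where "E = hardy_energy"
  define Q where "Q = 2 * real n + 2"
  have pow: "\<bar>f x\<bar> powr (2 * real dir_weight_real) = f x ^ (2 * dir_weight_real)" if "dir_weight_real > 0" for x dir_weight_real
    using that powr_realpow'[of "\<bar>f x\<bar>" "2 * dir_weight_real"] by (simp add: power_even_abs)
  have powQ: "\<bar>f x\<bar> powr Q = f x ^ (2 * Suc n)" for x
    using pow[of "Suc n" x] by (simp add: Q_def algebra_simps)
  have pow2: "\<bar>f x\<bar> powr 2 = (f x)\<^sup>2" for x
    using pow[of 1 x] by simp
  have interp: "(LINT x|lborel. \<bar>f x\<bar> powr p) \<le> s powr (p - Q) * M + s powr (p - 2) * X"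
    if "2 \<le> p" "p \<le> Q" for p
  proof -
    have "(LINT x|lborel. \<bar>f x\<bar> powr p)
        \<le> (LINT x|lborel. s powr (p - Q) * f x ^ (2 * Suc n) + s powr (p - 2) * (f x)\<^sup>2)"
    proof (rule integral_mono)
      show "integrable lborel (\<lambda>x. s powr (p - Q) * f x ^ (2 * Suc n) + s powr (p - 2) * (f x)\<^sup>2)"
        by (intro Bochner_Integration.integrable_add integrable_mult_right integrable_power) simp_all
      show "\<bar>f x\<bar> powr p \<le> s powr (p - Q) * f x ^ (2 * Suc n) + s powr (p - 2) * (f x)\<^sup>2" for x
        using powr_interpolation[of "\<bar>f x\<bar>" s p Q] s(1) that unfolding powQ pow2 by simp
    qed (use integrable_powr that in auto)
    also have "\<dots> = s powr (p - Q) * M + s powr (p - 2) * X"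
      unfolding M_def X_def 
      by (subst Bochner_Integration.integral_add) (use integrable_power in \<open>simp_all del: mult_Suc_right power_Suc\<close>)
    finally show ?thesis .
  qed
  have M0: "M \<ge> 0" unfolding M_def by (rule integral_nonneg_AE) (auto simp: power_even_eq simp del: mult_Suc_right)
  have X0: "X \<ge> 0" unfolding X_def by (rule integral_nonneg_AE) auto
  have A0: "A \<ge> 0" unfolding A_def by (rule integral_nonneg_AE) auto
  have A: "A \<le> s powr (-2) * M + s powr (2 * real n - 2) * X"
    using interp[of "2 * real n"] n pow[OF n] by (simp add: Q_def A_def)
  have "M \<le> 4 * (real (2 * n + 3))\<^sup>2 * E * A"
    unfolding M_def A_def E_def by (rule hardy_planar(2)[OF basis n])
  also have "\<dots> \<le> s\<^sup>2 / 2 * A" using s(2) A0 by (intro mult_right_mono) (auto simp: E_def)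
  also have "\<dots> \<le> s\<^sup>2 / 2 * (s powr (-2) * M + s powr (2 * real n - 2) * X)"
    using A by (intro mult_left_mono) auto
  also have "\<dots> = M / 2 + s powr (2 * real n) * X / 2"
  proof -
    have "s\<^sup>2 = s powr 2" using s(1) by simp
    moreover have "s powr 2 * s powr (-2) = 1" "s powr 2 * s powr (2 * real n - 2) = s powr (2 * real n)"
      using s(1) by (simp_all only: powr_add[symmetric]) simp_all
    ultimately have "s\<^sup>2 * s powr (-2) = 1" "s\<^sup>2 * s powr (2 * real n - 2) = s powr (2 * real n)"
      by (simp_all only:)
    then show ?thesis by (simp add: distrib_left mult.assoc[symmetric])
  qed
  finally have M: "M \<le> s powr (2 * real n) * X" by simp
  have "(LINT x|lborel. \<bar>f x\<bar> powr q) \<le> s powr (q - Q) * M + s powr (q - 2) * X"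
    using interp[of q] q by (simp add: Q_def)
  also have "\<dots> \<le> s powr (q - Q) * (s powr (2 * real n) * X) + s powr (q - 2) * X"
    using M by (intro add_right_mono mult_left_mono) auto
  also have "s powr (q - Q) * (s powr (2 * real n) * X) = s powr (q - 2) * X"
    by (simp add: Q_def mult.assoc[symmetric] powr_add[symmetric])
  finally show ?thesis by (simp add: X_def)
qed

lemma gagliardo_nirenberg_one_dim_real:
  fixes q s :: real
  assumes dim: "DIM('a) = 1" and q: "2 \<le> q"
    and s: "s \<ge> 0" "100 * hardy_energy * (LINT x|lborel. (f x)\<^sup>2) \<le> s\<^sup>2"
  shows "(LINT x|lborel. \<bar>f x\<bar> powr q) \<le> s powr ((q - 2) / 2) * (LINT x|lborel. (f x)\<^sup>2)"
proof -
  have pt: "\<bar>f x\<bar> powr q \<le> s powr ((q - 2) / 2) * (f x)\<^sup>2" for x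
  proof (cases "f x = 0")
    case False
    have "((f x)\<^sup>2)\<^sup>2 \<le> s\<^sup>2" using hardy_one_dim(2)[OF dim, of x] s(2) by simp
    then have "(f x)\<^sup>2 \<le> s" using s(1) power2_le_imp_le by blast
    have "\<bar>f x\<bar> powr q = \<bar>f x\<bar> powr (2 * ((q - 2) / 2)) * \<bar>f x\<bar> powr 2"
      by (simp only: powr_add[symmetric]) (simp add: field_simps)
    also have "\<dots> = ((f x)\<^sup>2) powr ((q - 2) / 2) * (f x)\<^sup>2"
      using False by (subst powr_powr[symmetric]) simp
    also have "\<dots> \<le> s powr ((q - 2) / 2) * (f x)\<^sup>2"
      using \<open>(f x)\<^sup>2 \<le> s\<close> q by (intro mult_right_mono powr_mono2) auto
    finally show ?thesis .
  qed auto
  have "(LINT x|lborel. \<bar>f x\<bar> powr q) \<le> (LINT x|lborel. s powr ((q - 2) / 2) * (f x)\<^sup>2)"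
    using integrable_powr[of q] integrable_power[of 2] q pt by (intro integral_mono) auto
  then show ?thesis by simp
qed


end

section \<open>Complex-valued test functions\<close>

lemma C0_infty_derivatives:
  fixes u :: "'a::euclidean_space \<Rightarrow> complex"
  assumes "u \<in> C0_infty \<Omega>"
  shows "(u has_derivative frechet_derivative u (at x)) (at x)"
    and "continuous_on UNIV (\<lambda>x. frechet_derivative u (at x) v)"
proof -
  have "Ck (Suc 0) u" using assms by (auto simp: C0_infty_def smooth_def)
  then have diff: "u differentiable (at x)"
    and cont: "b \<in> Basis \<Longrightarrow> continuous_on UNIV (\<lambda>x. frechet_derivative u (at x) b)" for x b
    by auto
  show D: "(u has_derivative frechet_derivative u (at x)) (at x)" for x
    using diff frechet_derivative_works by blast
  have "frechet_derivative u (at x) v = (\<Sum>b\<in>Basis. (v \<bullet> b) *\<^sub>R frechet_derivative u (at x) b)" for x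
  proof -
    have lin: "linear (frechet_derivative u (at x))" using D has_derivative_linear by blast
    show ?thesis
      by (subst euclidean_representation[of v, symmetric]) (simp add: linear_sum[OF lin] linear_scale[OF lin])
  qed
  then show "continuous_on UNIV (\<lambda>x. frechet_derivative u (at x) v)"
    using cont by (simp add: continuous_on_sum continuous_on_scaleR)
qed

lemma C0_infty_parts:
  fixes u :: "'a::euclidean_space \<Rightarrow> complex"
  assumes u: "u \<in> C0_infty \<Omega>" and \<Omega>: "open \<Omega>" and T: "T = Re \<or> T = Im"
  shows "compactly_supported_C1 (\<lambda>x. T (u x)) (\<lambda>x v. T (frechet_derivative u (at x) v))
    (closure {x. u x \<noteq> 0}) \<Omega>"
proof
  have bl: "bounded_linear T" using T bounded_linear_Re bounded_linear_Im by auto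
  show "((\<lambda>x. T (u x)) has_derivative (\<lambda>v. T (frechet_derivative u (at x) v))) (at x)" for x
    by (rule bounded_linear.has_derivative[OF bl C0_infty_derivatives(1)[OF u]])
  show "continuous_on UNIV (\<lambda>x. T (frechet_derivative u (at x) v))" for v
    by (rule bounded_linear.continuous_on[OF bl C0_infty_derivatives(2)[OF u]])
  show "T (u x) = 0" if "x \<notin> closure {x. u x \<noteq> 0}" for x
  proof -
    have "u x = 0" using that closure_subset[of "{x. u x \<noteq> 0}"] by blast
    then show ?thesis using T by auto
  qed
qed (use u \<Omega> in \<open>auto simp: C0_infty_def\<close>)

context
  fixes u :: "'a::euclidean_space \<Rightarrow> complex" and \<Omega> :: "'a set"
  assumes u: "u \<in> C0_infty \<Omega>" and \<Omega>: "open \<Omega>"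
begin

interpretation f: compactly_supported_C1 "\<lambda>x. Re (u x)" "\<lambda>x v. Re (frechet_derivative u (at x) v)"
    "closure {x. u x \<noteq> 0}" \<Omega>
  by (rule C0_infty_parts[OF u \<Omega>]) simp

interpretation g: compactly_supported_C1 "\<lambda>x. Im (u x)" "\<lambda>x v. Im (frechet_derivative u (at x) v)"
    "closure {x. u x \<noteq> 0}" \<Omega>
  by (rule C0_infty_parts[OF u \<Omega>]) simp

lemma set_integral_eq_of_support:
  fixes F :: "'a \<Rightarrow> real"
  assumes "\<And>x. x \<in> \<Omega> \<Longrightarrow> F x = G x" "\<And>x. x \<notin> closure {x. u x \<noteq> 0} \<Longrightarrow> G x = 0"
  shows "(LINT x:\<Omega>|lborel. F x) = (LINT x|lborel. G x)"
  unfolding set_lebesgue_integral_def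
  by (rule Bochner_Integration.integral_cong) (use assms f.K(2) in \<open>auto simp: indicator_def\<close>)

text \<open>On the support of \<open>u\<close> the mean weight is finite, so that the quotient of extended reals is a genuine real number there.
Elsewhere \<open>u\<close> vanishes and so does the quotient, whatever the value of the weight.\<close>

lemma energy_split:
  "(LINT x:\<Omega>|lborel. grad_norm_sq u x - enn2real (ennreal ((cmod (u x))\<^sup>2) / (4 * (hardy_weight \<Omega> x)\<^sup>2)))
    = f.hardy_energy + g.hardy_energy"
proof -
  let ?W = "\<lambda>x. enn2real (mean_dir_weight \<Omega> x)"
  let ?e = "\<lambda>T x. (\<Sum>b\<in>Basis. (T (frechet_derivative u (at x) b))\<^sup>2) - (T (u x))\<^sup>2 * ?W x / 4"
  have "enn2real (ennreal ((cmod (u x))\<^sup>2) / (4 * (hardy_weight \<Omega> x)\<^sup>2)) = (cmod (u x))\<^sup>2 * ?W x / 4" for x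
  proof (cases "u x = 0")
    case False
    then have "x \<in> closure {x. u x \<noteq> 0}" using closure_subset[of "{x. u x \<noteq> 0}"] by auto
    from hardy_weight_term[OF f.mean_dir_weight_finite[OF this]] show ?thesis .
  qed simp
  then have "(LINT x:\<Omega>|lborel. grad_norm_sq u x - enn2real (ennreal ((cmod (u x))\<^sup>2) / (4 * (hardy_weight \<Omega> x)\<^sup>2)))
      = (LINT x|lborel. ?e Re x + ?e Im x)"
    by (intro set_integral_eq_of_support)
      (auto simp: grad_norm_sq_def cmod_power2 sum.distrib algebra_simps add_divide_distrib
        f.Df_eq_0 g.Df_eq_0 f.K(3) g.K(3))
  then show ?thesis
    unfolding f.hardy_energy_def g.hardy_energy_def
    using f.integrable_hardy_density g.integrable_hardy_density by simp
qed

lemma mass_split: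
  "(LINT x:\<Omega>|lborel. (cmod (u x))\<^sup>2) = (LINT x|lborel. (Re (u x))\<^sup>2) + (LINT x|lborel. (Im (u x))\<^sup>2)"
proof -
  have "(LINT x:\<Omega>|lborel. (cmod (u x))\<^sup>2) = (LINT x|lborel. (Re (u x))\<^sup>2 + (Im (u x))\<^sup>2)"
    by (rule set_integral_eq_of_support) (auto simp: cmod_power2 f.K(3) g.K(3))
  then show ?thesis using f.integrable_power[of 2] g.integrable_power[of 2] by simp
qed

lemma power_norm_split:
  fixes q :: real
  assumes q: "q > 0"
  shows "(LINT x:\<Omega>|lborel. cmod (u x) powr q) \<le>
    2 powr q * ((LINT x|lborel. \<bar>Re (u x)\<bar> powr q) + (LINT x|lborel. \<bar>Im (u x)\<bar> powr q))"
proof -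
  have pt: "cmod z powr q \<le> 2 powr q * (\<bar>Re z\<bar> powr q + \<bar>Im z\<bar> powr q)" for z
  proof -
    have "cmod z powr q \<le> (2 * max \<bar>Re z\<bar> \<bar>Im z\<bar>) powr q"
      using q cmod_le[of z] by (intro powr_mono2) (auto simp: max_def)
    also have "\<dots> = 2 powr q * max \<bar>Re z\<bar> \<bar>Im z\<bar> powr q" by (simp add: powr_mult)
    also have "max \<bar>Re z\<bar> \<bar>Im z\<bar> powr q \<le> \<bar>Re z\<bar> powr q + \<bar>Im z\<bar> powr q" by (simp add: max_def)
    finally show ?thesis by simp
  qed
  have cont: "continuous_on UNIV u"
    using C0_infty_derivatives(1)[OF u] by (meson has_derivative_continuous_on has_derivative_at_withinI)
  have int: "integrable lborel (\<lambda>x. cmod (u x) powr q)"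
  proof (rule integrable_lborel_continuous_compact_support[OF _ f.K(1)])
    show "continuous_on UNIV (\<lambda>x. cmod (u x) powr q)"
      using q by (intro continuous_on_powr' continuous_on_norm cont continuous_on_const) auto
    show "cmod (u x) powr q = 0" if "x \<notin> closure {x. u x \<noteq> 0}" for x
      using that closure_subset[of "{x. u x \<noteq> 0}"] by auto
  qed
  have "(LINT x:\<Omega>|lborel. cmod (u x) powr q) = (LINT x|lborel. cmod (u x) powr q)"
    using closure_subset[of "{x. u x \<noteq> 0}"] by (intro set_integral_eq_of_support) auto
  also have "\<dots> \<le> (LINT x|lborel. 2 powr q * (\<bar>Re (u x)\<bar> powr q + \<bar>Im (u x)\<bar> powr q))"
    using int f.integrable_powr[OF q] g.integrable_powr[OF q] pt by (intro integral_mono) auto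
  also have "\<dots> = 2 powr q * ((LINT x|lborel. \<bar>Re (u x)\<bar> powr q) + (LINT x|lborel. \<bar>Im (u x)\<bar> powr q))"
    using f.integrable_powr[OF q] g.integrable_powr[OF q] by simp
  finally show ?thesis .
qed

private abbreviation (input) "J q \<equiv> LINT x:\<Omega>|lborel. cmod (u x) powr q"
private abbreviation (input) "X \<equiv> LINT x:\<Omega>|lborel. (cmod (u x))\<^sup>2"
private abbreviation (input) "E \<equiv> LINT x:\<Omega>|lborel. grad_norm_sq u x
   - enn2real (ennreal ((cmod (u x))\<^sup>2) / (4 * (hardy_weight \<Omega> x)\<^sup>2))"

private lemma X_parts_nonneg: "0 \<le> (LINT x|lborel. (Re (u x))\<^sup>2)" "0 \<le> (LINT x|lborel. (Im (u x))\<^sup>2)"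
  by (rule integral_nonneg_AE, simp)+

lemma gagliardo_nirenberg_planar:
  fixes n :: nat and q :: real
  assumes dim: "DIM('a) = 2" and n: "n > 0" and q: "2 < q" "q \<le> 2 * n + 2"
  shows "J q \<le> 2 powr q * 2 * (8 * (2 * real n + 3)\<^sup>2 * E) powr ((q - 2) / 2) * X"
    and "E \<ge> 0"
proof -
  obtain b1 b2 :: 'a where basis: "Basis = {b1, b2}" "b1 \<noteq> b2"
    using dim card_2_iff by metis
  have E0: "f.hardy_energy \<ge> 0" "g.hardy_energy \<ge> 0"
    using f.hardy_planar(1)[OF basis n] g.hardy_planar(1)[OF basis n] by auto
  then show "E \<ge> 0" unfolding energy_split by simp
  define c where "c = 8 * (2 * real n + 3)\<^sup>2"
  have c: "c > 0" by (simp add: c_def)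
  have J: "J q \<le> 2 powr q * 2 * s powr (q - 2) * X" if s: "s > 0" "c * E \<le> s\<^sup>2" for s
  proof -
    have "c * f.hardy_energy \<le> s\<^sup>2" "c * g.hardy_energy \<le> s\<^sup>2"
      using s(2) E0 c mult_nonneg_nonneg[of c] unfolding energy_split by (auto simp: distrib_left add_increasing)
       (smt (verit) mult_nonneg_nonneg)+
    then have "(LINT x|lborel. \<bar>Re (u x)\<bar> powr q) \<le> 2 * s powr (q - 2) * (LINT x|lborel. (Re (u x))\<^sup>2)"
      "(LINT x|lborel. \<bar>Im (u x)\<bar> powr q) \<le> 2 * s powr (q - 2) * (LINT x|lborel. (Im (u x))\<^sup>2)"
      using q s(1)
      by (auto intro!: f.gagliardo_nirenberg_planar_real[OF basis n] g.gagliardo_nirenberg_planar_real[OF basis n]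
          simp: c_def)
    then have "J q \<le> 2 powr q * (2 * s powr (q - 2) * (LINT x|lborel. (Re (u x))\<^sup>2)
        + 2 * s powr (q - 2) * (LINT x|lborel. (Im (u x))\<^sup>2))"
      using q by (intro order_trans[OF power_norm_split]) (auto intro!: mult_left_mono add_mono)
    then show ?thesis unfolding mass_split by (simp add: algebra_simps)
  qed
  show "J q \<le> 2 powr q * 2 * (8 * (2 * real n + 3)\<^sup>2 * E) powr ((q - 2) / 2) * X"
  proof (cases "E = 0")
    case False
    then have "c * E > 0" using c \<open>E \<ge> 0\<close> by simp
    then have "J q \<le> 2 powr q * 2 * sqrt (c * E) powr (q - 2) * X" by (intro J) auto
    also have "sqrt (c * E) powr (q - 2) = (c * E) powr ((q - 2) / 2)"
      using \<open>c * E > 0\<close> by (simp add: powr_half_sqrt[symmetric] powr_powr)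
    finally show ?thesis unfolding c_def .
  next
    case True
    \<comment> \<open>Every positive \<open>s\<close> is admissible here, and the bound tends to zero with \<open>s\<close>.\<close>
    have "((\<lambda>s. 2 powr q * 2 * s powr (q - 2) * X) \<longlongrightarrow> 2 powr q * 2 * 0 powr (q - 2) * X) (at_right 0)"
      using q by (intro tendsto_intros tendsto_powr') (auto intro: eventually_mono[OF eventually_at_right_less])
    moreover have "eventually (\<lambda>s. J q \<le> 2 powr q * 2 * s powr (q - 2) * X) (at_right 0)"
      using J True by (auto simp: eventually_at_right_field intro!: exI[of _ 1])
    ultimately have "J q \<le> 2 powr q * 2 * 0 powr (q - 2) * X"
      by (intro tendsto_lowerbound) auto
    then show ?thesis using True by simp
  qed
qed

lemma gagliardo_nirenberg_one_dim:
  fixes q :: real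
  assumes dim: "DIM('a) = 1" and q: "2 < q"
  shows "J q \<le> 2 powr q * (100 * E * X) powr ((q - 2) / 4) * X"
    and "E \<ge> 0"
proof -
  have E0: "f.hardy_energy \<ge> 0" "g.hardy_energy \<ge> 0"
    using f.hardy_one_dim(1)[OF dim] g.hardy_one_dim(1)[OF dim] by auto
  then show E: "E \<ge> 0" unfolding energy_split by simp
  have X: "X \<ge> 0" unfolding mass_split using X_parts_nonneg by simp
  define s where "s = sqrt (100 * E * X)"
  have s: "s \<ge> 0" "s\<^sup>2 = 100 * E * X" using E X by (auto simp: s_def)
  have "100 * f.hardy_energy * (LINT x|lborel. (Re (u x))\<^sup>2) \<le> s\<^sup>2"
       "100 * g.hardy_energy * (LINT x|lborel. (Im (u x))\<^sup>2) \<le> s\<^sup>2"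
    unfolding s(2) energy_split mass_split using E0 X_parts_nonneg by (auto intro!: mult_mono)
  then have "(LINT x|lborel. \<bar>Re (u x)\<bar> powr q) \<le> s powr ((q - 2) / 2) * (LINT x|lborel. (Re (u x))\<^sup>2)"
      "(LINT x|lborel. \<bar>Im (u x)\<bar> powr q) \<le> s powr ((q - 2) / 2) * (LINT x|lborel. (Im (u x))\<^sup>2)"
    using q s(1) f.gagliardo_nirenberg_one_dim_real[OF dim] g.gagliardo_nirenberg_one_dim_real[OF dim] by auto
  then have "J q \<le> 2 powr q * (s powr ((q - 2) / 2) * (LINT x|lborel. (Re (u x))\<^sup>2)
        + s powr ((q - 2) / 2) * (LINT x|lborel. (Im (u x))\<^sup>2))"
    using q by (intro order_trans[OF power_norm_split]) (auto intro!: mult_left_mono add_mono)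
  also have "\<dots> = 2 powr q * s powr ((q - 2) / 2) * X" unfolding mass_split by (simp add: algebra_simps)
  also have "s powr ((q - 2) / 2) = (100 * E * X) powr ((q - 2) / 4)"
    using E X by (simp add: s_def powr_half_sqrt[symmetric] powr_powr)
  finally show "J q \<le> 2 powr q * (100 * E * X) powr ((q - 2) / 4) * X" .
qed

lemma mass_nonneg: "X \<ge> 0"
  unfolding mass_split using X_parts_nonneg by simp

end

theorem theorem1p2:
  fixes q \<theta> :: real
  assumes "CARD('n::finite) = 1 \<or> CARD('n) = 2"
    and "2 \<le> q"
    and "\<theta> = real CARD('n) / 2 * (1 - 2 / q)"
  shows "\<exists>K>0. \<forall>(\<Omega> :: (real ^ 'n) set) (u :: real ^ 'n \<Rightarrow> complex).
    is_domain \<Omega> \<and> \<Omega> \<noteq> UNIV \<and> u \<in> C0_infty \<Omega> \<longrightarrow>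
      rpow (LINT x:\<Omega>|lborel. grad_norm_sq u x
              - enn2real (ennreal ((cmod (u x))\<^sup>2) / (4 * (hardy_weight \<Omega> x)\<^sup>2))) \<theta>
        * rpow (LINT x:\<Omega>|lborel. (cmod (u x))\<^sup>2) (1 - \<theta>)
      \<ge> K * (LINT x:\<Omega>|lborel. (cmod (u x)) powr q) powr (2 / q)"
    (is "\<exists>K>0. \<forall>\<Omega> u. ?dom \<Omega> u \<longrightarrow> rpow (?E \<Omega> u) \<theta> * rpow (?X \<Omega> u) (1 - \<theta>) \<ge> K * ?J \<Omega> u powr (2 / q)")
proof (cases "q = 2")
  case True
  then have \<theta>: "\<theta> = 0" using assms(3) by simp
  have "?J \<Omega> u = ?X \<Omega> u" for \<Omega> u using True by simp
  moreover have "?X \<Omega> u \<ge> 0" for \<Omega> u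
    unfolding set_lebesgue_integral_def by (rule integral_nonneg_AE) auto
  ultimately show ?thesis using True by (intro exI[of _ 1]) (simp add: \<theta> rpow_def)
next
  case False
  then have q: "q > 2" using assms(2) by simp
  have J0: "?J \<Omega> u \<ge> 0" for \<Omega> u
    unfolding set_lebesgue_integral_def by (rule integral_nonneg_AE) auto
  have \<theta>: "\<theta> > 0" "\<theta> < 1"
  proof -
    define r where "r = 2 / q"
    have r: "0 < r" "r < 1" using q by (auto simp: r_def)
    moreover have "\<theta> = (1 - r) / 2 \<or> \<theta> = 1 - r"
      using assms(1) unfolding assms(3) r_def[symmetric] by (elim disjE) simp_all
    ultimately have "\<theta> > 0 \<and> \<theta> < 1" by auto
    then show "\<theta> > 0" "\<theta> < 1" by simp_all
  qed
  obtain C where C: "C > 0" and main: "\<And>\<Omega> u. ?dom \<Omega> u \<Longrightarrow> ?E \<Omega> u \<ge> 0 \<and> ?X \<Omega> u \<ge> 0 \<and>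
      ?J \<Omega> u \<le> C * ?E \<Omega> u powr (\<theta> * q / 2) * ?X \<Omega> u powr ((1 - \<theta>) * q / 2)"
  proof (cases "CARD('n) = 1")
    case True
    have exps: "\<theta> * q / 2 = (q - 2) / 4" "(1 - \<theta>) * q / 2 = (q - 2) / 4 + 1"
      using q unfolding assms(3) True by (auto simp: field_simps)
    show ?thesis
    proof (rule that[of "2 powr q * 100 powr ((q - 2) / 4)"])
      fix \<Omega> :: "(real ^ 'n) set" and u :: "real ^ 'n \<Rightarrow> complex" assume "?dom \<Omega> u"
      then have u: "u \<in> C0_infty \<Omega>" "open \<Omega>" by (auto simp: is_domain_def)
      note GN = gagliardo_nirenberg_one_dim[OF u _ q] mass_nonneg[OF u]
      have X: "?X \<Omega> u powr ((q - 2) / 4 + 1) = ?X \<Omega> u powr ((q - 2) / 4) * ?X \<Omega> u"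
        using GN(3) by (simp add: powr_add)
      show "?E \<Omega> u \<ge> 0 \<and> ?X \<Omega> u \<ge> 0 \<and>
        ?J \<Omega> u \<le> 2 powr q * 100 powr ((q - 2) / 4) * ?E \<Omega> u powr (\<theta> * q / 2) * ?X \<Omega> u powr ((1 - \<theta>) * q / 2)"
        using GN True unfolding exps X by (simp add: powr_mult mult_ac)
    qed simp
  next
    case False
    then have card: "CARD('n) = 2" using assms(1) by simp
    have exps: "\<theta> * q / 2 = (q - 2) / 2" "(1 - \<theta>) * q / 2 = 1"
      using q unfolding assms(3) card by (auto simp: field_simps)
    obtain n :: nat where n: "n > 0" "q \<le> 2 * n + 2"
    proof (rule that[of "nat \<lceil>q\<rceil>"])
      show "q \<le> real (2 * nat \<lceil>q\<rceil> + 2)" using q by linarith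
    qed (use q in simp)
    show ?thesis
    proof (rule that[of "2 powr q * 2 * (8 * (2 * real n + 3)\<^sup>2) powr ((q - 2) / 2)"])
      fix \<Omega> :: "(real ^ 'n) set" and u :: "real ^ 'n \<Rightarrow> complex" assume "?dom \<Omega> u"
      then have u: "u \<in> C0_infty \<Omega>" "open \<Omega>" by (auto simp: is_domain_def)
      note GN = gagliardo_nirenberg_planar[OF u _ n(1) q] mass_nonneg[OF u]
      show "?E \<Omega> u \<ge> 0 \<and> ?X \<Omega> u \<ge> 0 \<and>
        ?J \<Omega> u \<le> 2 powr q * 2 * (8 * (2 * real n + 3)\<^sup>2) powr ((q - 2) / 2)
          * ?E \<Omega> u powr (\<theta> * q / 2) * ?X \<Omega> u powr ((1 - \<theta>) * q / 2)"
        using GN card n(2) unfolding exps by (simp add: powr_mult mult_ac)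
    qed (use n in simp)
  qed
  show ?thesis
  proof (intro exI[of _ "1 / C powr (2 / q)"] conjI allI impI)
    show "1 / C powr (2 / q) > 0" using C by simp
    fix \<Omega> :: "(real ^ 'n) set" and u :: "real ^ 'n \<Rightarrow> complex" assume dom: "?dom \<Omega> u"
    note m = main[OF dom]
    have "?J \<Omega> u powr (2 / q) \<le> (C * ?E \<Omega> u powr (\<theta> * q / 2) * ?X \<Omega> u powr ((1 - \<theta>) * q / 2)) powr (2 / q)"
      using m J0[where \<Omega> = \<Omega> and u = u] q by (intro powr_mono2) auto
    also have "\<dots> = C powr (2 / q) * (?E \<Omega> u powr \<theta> * ?X \<Omega> u powr (1 - \<theta>))"
      using C q by (simp add: powr_mult powr_powr)
    finally show "rpow (?E \<Omega> u) \<theta> * rpow (?X \<Omega> u) (1 - \<theta>) \<ge> 1 / C powr (2 / q) * ?J \<Omega> u powr (2 / q)"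
      using C \<theta> by (simp add: rpow_def field_simps)
  qed
qed

end
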